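(* Let $\xi$ be a fixed Higgs tensor on $\mathbb{T}^n$. The periodic HK-energy $\widehat{\mathcal F}(\cdot,\xi)$ is convex along linear paths in $$\mathcal A(\xi)=\left\{u\text{ symplectic potential}: r(\xi\,D^2u\,\bar\xi\,D^2u)<1\right\}.$$ That is, if $u_0,u_1$ are symplectic potentials such that $u_t=(1-t)u_0+tu_1\in\mathcal A(\xi)$ for all $t\in[0,1]$, then $t\mapsto\widehat{\mathcal F}(u_t,\xi)$ is convex on $[0,1]$.
   Context: $\mathbb{T}^n=\mathbb{R}^n/\mathbb{Z}^n$ with coordinates $y$ and Lebesgue measure $d\mu$. A symplectic potential is a function $u(y)=\frac12|y|^2+\phi(y)$ with $\phi$ smooth and $\mathbb{Z}^n$-periodic and $D^2u$ positive definite everywhere. A Higgs tensor is a smooth $\mathbb{Z}^n$-periodic function $\xi=(\xi^{ab}(y))$ with values in complex symmetric $n\times n$ matrices; $\bar\xi$ is its complex conjugate. $r$ is the spectral radius, and the bound $r<1$ is required at every point. For $u\in\mathcal A(\xi)$ the matrix $\xi\,D^2u\,\bar\xi\,D^2u$ is diagonalizable with eigenvalues in $[0,1)$. For $x\in[0,1]$ let $f(x)=1-(1-x)^{1/2}+\log(1+(1-x)^{1/2})$ and set $\rho(\xi\,D^2u\,\bar\xi\,D^2u)=\mathrm{Tr}\,f(\xi\,D^2u\,\bar\xi\,D^2u)$ (the sum of $f$ over the eigenvalues). The periodic HK-energy is $$\widehat{\mathcal F}(u,\xi)=-\frac12\int_{\mathbb T^n}\log\det(D^2u)\,d\mu+\frac12\int_{\mathbb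 T^n}\rho(\xi\,D^2u\,\bar\xi\,D^2u)\,d\mu.$$ *)

theory Defs
  imports "HOL-Analysis.Analysis" "HOL-Computational_Algebra.Polynomial_Factorial" "HOL-Computational_Algebra.Fundamental_Theorem_Algebra"
begin

text \<open>Functions on the torus \<open>\<real>\<^sup>n / \<int>\<^sup>n\<close> are treated as \<open>\<int>\<^sup>n\<close>-periodic functions on \<open>real ^ 'n\<close>,
  and integrals over the torus as integrals over the fundamental domain \<open>[0,1]\<^sup>n\<close>.\<close>

definition periodic :: "(real ^ 'n \<Rightarrow> 'b) \<Rightarrow> bool" where
  "periodic f \<longleftrightarrow> (\<forall>y k. (\<forall>i. k $ i \<in> \<int>) \<longrightarrow> f (y + k) = f y)"

definition torus_integral :: "(real ^ 'n \<Rightarrow> real) \<Rightarrow> real" where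
  "torus_integral f = (LINT y:cbox 0 1|lborel. f y)"

definition partial_deriv :: "'n \<Rightarrow> (real ^ 'n \<Rightarrow> 'b::real_normed_vector) \<Rightarrow> real ^ 'n \<Rightarrow> 'b" where
  "partial_deriv i f y = frechet_derivative f (at y) (axis i 1)"

primrec C_class :: "nat \<Rightarrow> (real ^ 'n \<Rightarrow> 'b::real_normed_vector) \<Rightarrow> bool" where
  "C_class 0 f \<longleftrightarrow> continuous_on UNIV f"
| "C_class (Suc k) f \<longleftrightarrow> (\<forall>y. f differentiable (at y)) \<and> (\<forall>i. C_class k (partial_deriv i f))"

definition smooth :: "(real ^ 'n \<Rightarrow> 'b::real_normed_vector) \<Rightarrow> bool" where
  "smooth f \<longleftrightarrow> (\<forall>k. C_class k f)"

definition hessian :: "(real ^ 'n \<Rightarrow> real) \<Rightarrow> real ^ 'n \<Rightarrow> real ^ 'n ^ 'n" where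
  "hessian u y = (\<chi> i j. partial_deriv i (partial_deriv j u) y)"

definition pos_definite :: "real ^ 'n ^ 'n \<Rightarrow> bool" where
  "pos_definite A \<longleftrightarrow> transpose A = A \<and> (\<forall>v. v \<noteq> 0 \<longrightarrow> 0 < v \<bullet> (A *v v))"

definition symplectic_potential :: "(real ^ 'n \<Rightarrow> real) \<Rightarrow> bool" where
  "symplectic_potential u \<longleftrightarrow>
     (\<exists>\<phi>. smooth \<phi> \<and> periodic \<phi> \<and> (\<forall>y. u y = 1/2 * (norm y)\<^sup>2 + \<phi> y)) \<and>
     (\<forall>y. pos_definite (hessian u y))"

definition Higgs_tensor :: "(real ^ 'n \<Rightarrow> complex ^ 'n ^ 'n) \<Rightarrow> bool" where
  "Higgs_tensor \<xi> \<longleftrightarrow> smooth \<xi> \<and> periodic \<xi> \<and> (\<forall>y. transpose (\<xi> y) = \<xi> y)"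

definition eigenvalues :: "complex ^ 'n ^ 'n \<Rightarrow> complex set" where
  "eigenvalues A = {c. \<exists>v. v \<noteq> 0 \<and> A *v v = c *s v}"

definition spectral_radius :: "complex ^ 'n ^ 'n \<Rightarrow> real" where
  "spectral_radius A = Max (cmod ` eigenvalues A)"

definition char_poly :: "complex ^ 'n ^ 'n \<Rightarrow> complex poly" where
  "char_poly A = det (mat [:0, 1:] - map_matrix (\<lambda>c. [:c:]) A)"

text \<open>\<open>Tr g(A)\<close> for a diagonalizable matrix \<open>A\<close> with real eigenvalues: the sum of \<open>g\<close> over the
  eigenvalues, counted with multiplicity.  Only for such \<open>A\<close> is the value meaningful, the real part
  merely turning a real eigenvalue into an element of type \<open>real\<close>.\<close>

definition trace_fun :: "(real \<Rightarrow> real) \<Rightarrow> complex ^ 'n ^ 'n \<Rightarrow> real" where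
  "trace_fun g A = (\<Sum>c\<in>#proots (char_poly A). g (Re c))"

definition HK_f :: "real \<Rightarrow> real" where
  "HK_f x = 1 - sqrt (1 - x) + ln (1 + sqrt (1 - x))"

definition HK_rho :: "complex ^ 'n ^ 'n \<Rightarrow> real" where
  "HK_rho A = trace_fun HK_f A"

definition HK_matrix ::
    "(real ^ 'n \<Rightarrow> real) \<Rightarrow> (real ^ 'n \<Rightarrow> complex ^ 'n ^ 'n) \<Rightarrow> real ^ 'n \<Rightarrow> complex ^ 'n ^ 'n" where
  "HK_matrix u \<xi> y =
     \<xi> y ** map_matrix complex_of_real (hessian u y) **
     map_matrix cnj (\<xi> y) ** map_matrix complex_of_real (hessian u y)"

definition HK_domain :: "(real ^ 'n \<Rightarrow> complex ^ 'n ^ 'n) \<Rightarrow> (real ^ 'n \<Rightarrow> real) set" where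
  "HK_domain \<xi> = {u. symplectic_potential u \<and> (\<forall>y. spectral_radius (HK_matrix u \<xi> y) < 1)}"

definition HK_energy :: "(real ^ 'n \<Rightarrow> real) \<Rightarrow> (real ^ 'n \<Rightarrow> complex ^ 'n ^ 'n) \<Rightarrow> real" where
  "HK_energy u \<xi> =
     - (1/2) * torus_integral (\<lambda>y. ln (det (hessian u y)))
     + 1/2 * torus_integral (\<lambda>y. HK_rho (HK_matrix u \<xi> y))"

end

theory Submission
  imports Defs
begin

text \<open>Write \<open>G = D\<^sup>2u(y)\<close> and \<open>n\<close> for the dimension. The integrand
  \<open>\<Phi>(G) = - log det G + Tr f(\<xi> G (cnj \<xi>) G)\<close> satisfies, for every Hermitian \<open>0 < K \<le> G\<close>,
  \<open>\<Phi>(G) \<ge> - log det K - Tr(K\<^sup>-\<^sup>1 G)/2 + Tr(K \<xi> G \<xi>\<^sup>*)/2 + n\<close>,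
  and for fixed \<open>K\<close> the right-hand side is affine in \<open>G\<close>. To see this, write \<open>G = R\<^sup>*R\<close> and
  \<open>S = R \<xi> R\<^sup>T\<close>, so that \<open>\<xi> G (cnj \<xi>) G\<close> is similar to \<open>S S\<^sup>*\<close>; in eigenbases of
  \<open>R\<^sup>-\<^sup>*K R\<^sup>-\<^sup>1\<close> and \<open>S S\<^sup>*\<close>, which are related by a doubly stochastic matrix, the claim reduces to
  \<open>log w - w/2 + q/(2w) + 1 \<le> f(q)\<close> for \<open>w \<ge> 1\<close> and \<open>0 \<le> q \<le> 1\<close>. There is equality for
  \<open>w = 1 + (1-q)\<^sup>1\<^sup>/\<^sup>2\<close>, and the corresponding \<open>K\<close> is strictly smaller than \<open>G\<close> because the spectral
  radius is less than 1. It therefore stays admissible for all matrices near \<open>G\<close>, so that \<open>\<Phi>\<close> has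
  a local affine support at every point of the path. As \<open>\<Phi>\<close> is also continuous along the path, it
  is convex there, and integration over the torus gives the theorem.\<close>

section \<open>Hermitian matrices\<close>

text \<open>A maximizer of \<open>x \<bullet> T x\<close> on the unit sphere of \<open>S\<close> is
  an eigenvector: its residual lies in \<open>S\<close> by invariance, and varying the maximizer in
  that direction would otherwise increase the Rayleigh quotient. Allowing a subspace permits
  induction on orthogonal complements.\<close>

lemma selfadjoint_eigenvector:
  fixes T :: "'a::euclidean_space \<Rightarrow> 'a"
  assumes lin: "linear T" and sym: "\<And>x y. x \<bullet> T y = T x \<bullet> y"
    and S: "subspace S" and inv: "\<And>x. x \<in> S \<Longrightarrow> T x \<in> S"
    and x0: "x0 \<in> S" "x0 \<noteq> 0"
  shows "\<exists>v \<mu>. v \<in> S \<and> norm v = 1 \<and> T v = \<mu> *\<^sub>R v"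
proof -
  have "compact (S \<inter> sphere 0 1)"
    using closed_subspace[OF S] by (simp add: closed_Int_compact)
  moreover have "S \<inter> sphere 0 1 \<noteq> {}"
  proof -
    have "(1 / norm x0) *\<^sub>R x0 \<in> S \<inter> sphere 0 1"
      using x0 S by (auto simp: subspace_scale)
    then show ?thesis by blast
  qed
  moreover have "continuous_on (S \<inter> sphere 0 1) (\<lambda>x. x \<bullet> T x)"
    using lin by (intro continuous_intros linear_continuous_on linear_linear[THEN iffD1] ) (auto simp: linear_conv_bounded_linear)
  ultimately obtain v where v: "v \<in> S" "norm v = 1"
    and max: "\<And>y. y \<in> S \<Longrightarrow> norm y = 1 \<Longrightarrow> y \<bullet> T y \<le> v \<bullet> T v"
    using continuous_attains_sup[of "S \<inter> sphere 0 1" "\<lambda>x. x \<bullet> T x"]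
    by (metis IntD1 IntD2 IntI dist_0_norm mem_sphere)
  define \<mu> where "\<mu> = v \<bullet> T v"
  have max': "y \<bullet> T y \<le> \<mu> * (y \<bullet> y)" if "y \<in> S" for y
  proof (cases "y = 0")
    case False
    have "((1 / norm y) *\<^sub>R y) \<bullet> T ((1 / norm y) *\<^sub>R y) \<le> \<mu>"
      unfolding \<mu>_def using False that S by (intro max) (auto simp: subspace_scale)
    then have "(y \<bullet> T y) / (norm y)\<^sup>2 \<le> \<mu>"
      using lin by (simp add: linear_scale power2_eq_square)
    then show ?thesis
      using False by (simp add: field_simps power2_norm_eq_inner)
  qed (use lin in \<open>simp add: linear_0\<close>)
  define w where "w = T v - \<mu> *\<^sub>R v"
  define M where "M = \<mu> * (w \<bullet> w) - w \<bullet> T w"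
  have wS: "w \<in> S"
    unfolding w_def using v S inv by (simp add: subspace_diff subspace_scale)
  have vv: "v \<bullet> v = 1"
    using v by (simp add: norm_eq_1)
  \<comment> \<open>Insert \<open>v + e *\<^sub>R w\<close> into \<open>max'\<close>: the constants
    and the terms in \<open>w \<bullet> v\<close> cancel, and division by \<open>e\<close> leaves
    the first-order term against \<open>e * M\<close>. A small \<open>e\<close> then forces
    \<open>w = 0\<close>.\<close>
  have key: "2 * (w \<bullet> w) \<le> e * M" if "e > 0" for e :: real
  proof -
    have "(v + e *\<^sub>R w) \<bullet> T (v + e *\<^sub>R w) \<le> \<mu> * ((v + e *\<^sub>R w) \<bullet> (v + e *\<^sub>R w))"
      using v S wS by (intro max') (simp add: subspace_add subspace_scale)
    moreover have "(v + e *\<^sub>R w) \<bullet> T (v + e *\<^sub>R w) = \<mu> + 2 * e * (w \<bullet> T v) + e\<^sup>2 * (w \<bullet> T w)"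
      using lin sym[of v w] unfolding \<mu>_def
      by (simp add: linear_add linear_scale inner_add_left inner_add_right inner_commute algebra_simps power2_eq_square)
    moreover have "(v + e *\<^sub>R w) \<bullet> (v + e *\<^sub>R w) = 1 + 2 * e * (w \<bullet> v) + e\<^sup>2 * (w \<bullet> w)"
      using vv by (simp add: inner_add_left inner_add_right inner_commute algebra_simps power2_eq_square)
    moreover have "w \<bullet> T v = w \<bullet> w + \<mu> * (w \<bullet> v)"
      by (simp add: w_def inner_diff_right)
    ultimately have "\<mu> + 2 * e * (w \<bullet> w + \<mu> * (w \<bullet> v)) + e\<^sup>2 * (w \<bullet> T w)
        \<le> \<mu> * (1 + 2 * e * (w \<bullet> v) + e\<^sup>2 * (w \<bullet> w))" by metis
    then have "e * (2 * (w \<bullet> w)) \<le> e * (e * M)"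
      unfolding M_def by (simp add: algebra_simps power2_eq_square)
    then show ?thesis using that by simp
  qed
  have "w = 0"
  proof (rule ccontr)
    assume "w \<noteq> 0"
    then have c: "w \<bullet> w > 0" by simp
    have "2 * (w \<bullet> w) \<le> (w \<bullet> w) / (\<bar>M\<bar> + 1) * M"
      using c by (intro key) (simp add: add_nonneg_pos)
    also have "\<dots> = (w \<bullet> w) * (M / (\<bar>M\<bar> + 1))" by simp
    also have "\<dots> \<le> (w \<bullet> w) * 1"
      using c by (intro mult_left_mono) (auto simp: divide_simps)
    finally show False using c by simp
  qed
  then show ?thesis using v unfolding w_def by auto
qed

section \<open>The Hermitian inner product and unitary diagonalization\<close>

definition cip :: "complex ^ 'n \<Rightarrow> complex ^ 'n \<Rightarrow> complex" where
  "cip x y = (\<Sum>i\<in>UNIV. cnj (x $ i) * y $ i)"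

definition adj :: "complex ^ 'n ^ 'm \<Rightarrow> complex ^ 'm ^ 'n" where
  "adj A = (\<chi> i j. cnj (A $ j $ i))"

definition diagm :: "('n \<Rightarrow> real) \<Rightarrow> complex ^ 'n ^ 'n" where
  "diagm d = (\<chi> i j. if i = j then complex_of_real (d i) else 0)"

lemma adj_mult: "adj (A ** B) = adj B ** adj A"
  by (simp add: adj_def matrix_matrix_mult_def vec_eq_iff mult.commute)

lemma adj_adj [simp]: "adj (adj A) = A"
  by (simp add: adj_def vec_eq_iff)

lemma adj_mat1 [simp]: "adj (mat 1) = mat 1"
  by (simp add: adj_def mat_def vec_eq_iff)

lemma adj_diagm [simp]: "adj (diagm d) = diagm d"
  by (simp add: adj_def diagm_def vec_eq_iff)

lemma cip_add: "cip x (y + z) = cip x y + cip x z"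
  by (simp add: cip_def algebra_simps sum.distrib)

lemma cip_diff: "cip x (y - z) = cip x y - cip x z"
  by (simp add: cip_def algebra_simps sum_subtractf)

lemma cip_scale: "cip x (c *s y) = c * cip x y"
  by (simp add: cip_def sum_distrib_left algebra_simps)

lemma cip_sum: "cip x (sum f J) = (\<Sum>j\<in>J. cip x (f j))"
proof -
  have z: "cip x 0 = 0" by (simp add: cip_def)
  show ?thesis
    by (induction J rule: infinite_finite_induct) (auto simp: cip_add z)
qed

lemma cip_scaleR: "cip x (r *\<^sub>R y) = complex_of_real r * cip x y"
  unfolding cip_def sum_distrib_left
  by (intro sum.cong) (simp_all add: scaleR_conv_of_real[where 'a = complex])

lemma cip_commute: "cip y x = cnj (cip x y)"
  by (simp add: cip_def algebra_simps)

text \<open>Bridge to the real Euclidean structure of \<open>complex ^ 'n\<close>, through which the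
  real eigenvector lemma applies to Hermitian matrices.\<close>

lemma Re_cip: "Re (cip x y) = x \<bullet> y"
  by (simp add: cip_def inner_vec_def inner_complex_def)

lemma cip_self: "cip x x = complex_of_real ((norm x)\<^sup>2)"
  by (simp add: complex_eq_iff Re_cip power2_norm_eq_inner)
     (simp add: cip_def)

lemma cip_adj: "cip x (A *v y) = cip (adj A *v x) y"
proof -
  have "cip x (A *v y) = (\<Sum>i\<in>UNIV. \<Sum>j\<in>UNIV. cnj (x $ i) * A $ i $ j * y $ j)"
    by (simp add: cip_def matrix_vector_mult_def sum_distrib_left mult.assoc)
  also have "\<dots> = (\<Sum>j\<in>UNIV. \<Sum>i\<in>UNIV. cnj (x $ i) * A $ i $ j * y $ j)"
    by (rule sum.swap)
  also have "\<dots> = cip (adj A *v x) y"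
    by (simp add: cip_def adj_def matrix_vector_mult_def sum_distrib_left sum_distrib_right mult_ac)
  finally show ?thesis .
qed

lemma inner_adj: "x \<bullet> (A *v y) = (adj A *v x) \<bullet> y"
  using arg_cong[OF cip_adj[of x A y], of Re] by (simp add: Re_cip)

lemma linear_cmatrix: "linear (\<lambda>x. (A :: complex ^ 'n ^ 'm) *v x)"
  by (rule linearI)
     (simp_all add: matrix_vector_mult_def vec_eq_iff algebra_simps sum.distrib scaleR_sum_right)

text \<open>A dimension count leaves a vector outside the complex span of fewer than
  \<open>CARD('n)\<close> vectors; a Gram-Schmidt step removes its components along them.\<close>

lemma orthonormal_extension:
  fixes b :: "'n::finite \<Rightarrow> complex ^ 'n"
  assumes J: "J \<noteq> UNIV" and b: "\<And>i j. i \<in> J \<Longrightarrow> j \<in> J \<Longrightarrow> cip (b i) (b j) = (if i = j then 1 else 0)"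
  shows "\<exists>x. x \<noteq> 0 \<and> (\<forall>j\<in>J. cip (b j) x = 0)"
proof -
  have "vec.dim (vec.span (b ` J)) \<le> card (b ` J)"
    by (simp add: vec.dim_le_card')
  also have "\<dots> \<le> card J" by (simp add: card_image_le)
  also have "\<dots> < CARD('n)"
    using J by (simp add: psubset_card_mono psubset_eq)
  finally have "vec.span (b ` J) \<noteq> (UNIV :: (complex ^ 'n) set)"
    by (metis card_cart_basis less_irrefl vec.dim_UNIV vec.dimension_def)
  then obtain z where z: "z \<notin> vec.span (b ` J)" by blast
  define x where "x = z - (\<Sum>j\<in>J. cip (b j) z *s b j)"
  have "x \<noteq> 0"
  proof
    assume "x = 0"
    then have "z = (\<Sum>j\<in>J. cip (b j) z *s b j)" by (simp add: x_def)
    also have "\<dots> \<in> vec.span (b ` J)"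
      by (intro vec.span_sum vec.span_scale vec.span_base) auto
    finally show False using z by simp
  qed
  moreover have "cip (b i) x = 0" if "i \<in> J" for i
  proof -
    have "(\<Sum>j\<in>J. cip (b j) z * cip (b i) (b j)) = (\<Sum>j\<in>J. if i = j then cip (b j) z else 0)"
      using that by (intro sum.cong) (auto simp: b)
    then show ?thesis
      using that by (simp add: x_def cip_diff cip_sum cip_scale)
  qed
  ultimately show ?thesis by blast
qed

text \<open>Grow an orthonormal family of eigenvectors one index at a time: the matrix preserves the
  orthogonal complement of those already found, so it has a further eigenvector there, with a real
  eigenvalue.\<close>

theorem hermitian_diagonalization:
  fixes A :: "complex ^ 'n ^ 'n"
  assumes A: "adj A = A"
  shows "\<exists>(U :: complex ^ 'n ^ 'n) d. adj U ** U = mat 1 \<and> U ** adj U = mat 1 \<and> A = U ** diagm d ** adj U"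
proof -
  have "\<exists>b d. (\<forall>i\<in>J. \<forall>j\<in>J. cip (b i) (b j) = (if i = j then 1 else 0)) \<and>
          (\<forall>j\<in>J. A *v b j = d j *\<^sub>R b j)" for J :: "'n set"
  proof (induction J rule: finite_induct[OF finite])
    case 1
    then show ?case by simp
  next
    case (2 k J)
    then obtain b d where b: "\<And>i j. i \<in> J \<Longrightarrow> j \<in> J \<Longrightarrow> cip (b i) (b j) = (if i = j then 1 else 0)"
      and d: "\<And>j. j \<in> J \<Longrightarrow> A *v b j = d j *\<^sub>R b j" by blast
    \<comment> \<open>\<open>S\<close> is used as a real subspace, but it is cut out by the complex
      product, so the new eigenvector is orthogonal to the old ones for \<open>cip\<close>.\<close>
    define S where "S = {x. \<forall>j\<in>J. cip (b j) x = 0}"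
    have S: "subspace S"
      unfolding S_def subspace_def by (simp add: cip_add cip_scaleR) (simp add: cip_def)
    obtain x0 where x0: "x0 \<in> S" "x0 \<noteq> 0"
      using orthonormal_extension[of J b] b 2 unfolding S_def by blast
    have inv: "A *v x \<in> S" if "x \<in> S" for x
    proof -
      have "cip (b j) (A *v x) = 0" if "j \<in> J" for j
      proof -
        have "cip (b j) (A *v x) = cnj (cip x (d j *\<^sub>R b j))"
          using that d by (subst cip_adj) (simp add: A cip_commute[of x])
        also have "\<dots> = complex_of_real (d j) * cip (b j) x"
          by (simp add: cip_scaleR cip_commute[of x])
        also have "\<dots> = 0" using \<open>x \<in> S\<close> that by (simp add: S_def)
        finally show ?thesis .
      qed
      then show ?thesis by (simp add: S_def)
    qed
    obtain v \<mu> where v: "v \<in> S" "norm v = 1" "A *v v = \<mu> *\<^sub>R v"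
      using selfadjoint_eigenvector[OF linear_cmatrix[of A] _ S inv x0] A inner_adj[of _ A] by metis
    have vb: "cip (b j) v = 0" "cip v (b j) = 0" if "j \<in> J" for j
      using v that cip_commute[of v "b j"] by (auto simp: S_def)
    have vv: "cip v v = 1" using v by (simp add: cip_self)
    show ?case
      using 2 b d v vb vv
      by (intro exI[of _ "b(k := v)"] exI[of _ "d(k := \<mu>)"]) auto
  qed
  from this[of UNIV] obtain b :: "'n \<Rightarrow> complex ^ 'n" and d where b: "\<And>i j. cip (b i) (b j) = (if i = j then 1 else 0)"
    and d: "\<And>j. A *v b j = d j *\<^sub>R b j"
    unfolding ball_UNIV by blast
  define U :: "complex ^ 'n ^ 'n" where "U = (\<chi> i j. b j $ i)"
  have 1: "adj U ** U = mat 1"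
    using b by (simp add: U_def adj_def matrix_matrix_mult_def mat_def vec_eq_iff cip_def)
  then have 2: "U ** adj U = mat 1" by (simp add: matrix_left_right_inverse)
  have "A ** U = U ** diagm d"
  proof -
    have "(A ** U) $ i $ j = (A *v b j) $ i" for i j
      by (simp add: U_def matrix_matrix_mult_def matrix_vector_mult_def)
    moreover have "(U ** diagm d) $ i $ j = (d j *\<^sub>R b j) $ i" for i j
    proof -
      have "(U ** diagm d) $ i $ j = b j $ i * complex_of_real (d j)"
        by (simp add: U_def diagm_def matrix_matrix_mult_def if_distrib[of "\<lambda>c. _ * c"] cong: if_cong)
      then show ?thesis by (simp add: scaleR_conv_of_real[where 'a = complex] mult.commute)
    qed
    ultimately show ?thesis using d by (simp add: vec_eq_iff)
  qed
  then have "U ** diagm d ** adj U = A ** (U ** adj U)" by (simp add: matrix_mul_assoc)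
  then show ?thesis using 1 2 by (metis matrix_mul_rid)
qed

section \<open>Diagonal matrices, positive definite forms and congruence\<close>

lemma transpose_adj: "transpose (adj A) = map_matrix cnj A"
  by (simp add: transpose_def adj_def vec_eq_iff)

lemma adj_transpose: "adj (transpose A) = map_matrix cnj A"
  by (simp add: transpose_def adj_def vec_eq_iff)

lemma det_adj: "det (adj A) = cnj (det (A :: complex ^ 'n ^ 'n))"
proof -
  have "det (map_matrix cnj A) = cnj (det A)" for A :: "complex ^ 'n ^ 'n"
    by (simp add: det_def)
  moreover have "adj A = transpose (map_matrix cnj A)"
    by (simp add: transpose_def adj_def vec_eq_iff)
  ultimately show ?thesis by (simp add: det_transpose)
qed

lemma mult_diagm_nth [simp]: "(M ** diagm d) $ i $ j = M $ i $ j * complex_of_real (d j)"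
  by (simp add: diagm_def matrix_matrix_mult_def if_distrib[of "\<lambda>c. _ * c"] cong: if_cong)

lemma diagm_mult_nth [simp]: "(diagm d ** M) $ i $ j = complex_of_real (d i) * M $ i $ j"
  by (simp add: diagm_def matrix_matrix_mult_def if_distrib[of "\<lambda>c. c * _"] cong: if_cong)

lemma diagm_nth: "diagm d $ i $ j = (if i = j then complex_of_real (d i) else 0)"
  by (simp add: diagm_def)

lemma diagm_mult: "diagm a ** diagm b = diagm (\<lambda>i. a i * b i)"
  by (simp add: vec_eq_iff diagm_nth)

lemma diagm_1: "diagm (\<lambda>i. 1) = mat 1"
  by (simp add: vec_eq_iff diagm_nth mat_def)

lemma diagm_vec_nth: "(diagm d *v y) $ i = complex_of_real (d i) * y $ i"
  by (simp add: diagm_def matrix_vector_mult_def if_distrib[of "\<lambda>c. c * _"] cong: if_cong)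

lemma det_diagm: "det (diagm d) = complex_of_real (\<Prod>i\<in>UNIV. d i)"
  by (subst det_diagonal) (simp_all add: diagm_nth)

lemma trace_diagm: "trace (diagm d) = complex_of_real (\<Sum>i\<in>UNIV. d i)"
  by (simp add: trace_def diagm_nth)

lemma inner_diagm_congruence:
  "x \<bullet> ((U ** diagm d ** adj U) *v x) = (\<Sum>i\<in>UNIV. d i * (cmod ((adj U *v x) $ i))\<^sup>2)"
proof -
  define y where "y = adj U *v x"
  have "x \<bullet> ((U ** diagm d ** adj U) *v x) = x \<bullet> (U *v (diagm d *v y))"
    by (simp add: y_def matrix_vector_mul_assoc matrix_mul_assoc)
  also have "\<dots> = y \<bullet> (diagm d *v y)" by (simp add: inner_adj y_def)
  also have "\<dots> = (\<Sum>i\<in>UNIV. d i * (cmod (y $ i))\<^sup>2)"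
    unfolding inner_vec_def diagm_vec_nth
    by (intro sum.cong) (simp_all add: inner_complex_def cmod_power2 algebra_simps power2_eq_square[of "Re _"] power2_eq_square[of "Im _"])
  finally show ?thesis by (simp add: y_def)
qed

text \<open>\<open>x \<bullet> (A *v x)\<close> is only the real part of
  \<open>cip x (A *v x)\<close>, but self-adjointness makes the latter real, so this is the usual
  Hermitian positivity.\<close>

definition herm_pd :: "complex ^ 'n ^ 'n \<Rightarrow> bool" where
  "herm_pd A \<longleftrightarrow> adj A = A \<and> (\<forall>x. x \<noteq> 0 \<longrightarrow> 0 < x \<bullet> (A *v x))"

text \<open>Reads an eigenvalue off the quadratic form, so that inequalities between forms become
  inequalities between eigenvalues.\<close>

lemma diag_entry_inner:
  fixes U :: "complex ^ 'n ^ 'n"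
  assumes U: "adj U ** U = mat 1"
  shows "U *v axis i 1 \<noteq> 0"
    and "(U *v axis i 1) \<bullet> ((U ** diagm d ** adj U) *v (U *v axis i 1)) = d i"
proof -
  have 1: "adj U *v (U *v axis i 1) = axis i (1 :: complex)"
    by (simp add: matrix_vector_mul_assoc U)
  then show "U *v axis i 1 \<noteq> 0"
    by (metis axis_eq_0_iff matrix_vector_mult_0_right zero_neq_one)
  have "(\<Sum>k\<in>UNIV. d k * (cmod (axis i (1::complex) $ k))\<^sup>2) = (\<Sum>k\<in>UNIV. if k = i then d k else 0)"
    by (intro sum.cong) (auto simp: axis_def)
  then show "(U *v axis i 1) \<bullet> ((U ** diagm d ** adj U) *v (U *v axis i 1)) = d i"
    by (simp add: inner_diagm_congruence 1)
qed

text \<open>Take the diagonal of square roots times the adjoint of a diagonalizing unitary;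
  positivity of the form makes the roots invertible.\<close>

lemma herm_pd_factorization:
  fixes G :: "complex ^ 'n ^ 'n"
  assumes "herm_pd G"
  shows "\<exists>(R :: complex ^ 'n ^ 'n) (R' :: complex ^ 'n ^ 'n). R' ** R = mat 1 \<and> R ** R' = mat 1 \<and> G = adj R ** R"
proof -
  obtain U :: "complex ^ 'n ^ 'n" and d where U: "adj U ** U = mat 1" "U ** adj U = mat 1" and G: "G = U ** diagm d ** adj U"
    using hermitian_diagonalization assms unfolding herm_pd_def by metis
  have d: "d i > 0" for i
    using diag_entry_inner[OF U(1), of i] assms unfolding herm_pd_def G by metis
  define R where "R = diagm (\<lambda>i. sqrt (d i)) ** adj U"
  define R' where "R' = U ** diagm (\<lambda>i. 1 / sqrt (d i))"
  have 0: "sqrt (d i) * (1 / sqrt (d i)) = 1" "sqrt (d i) * sqrt (d i) = d i" for i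
    using d[of i] by (auto simp: field_simps)
  have "R ** R' = diagm (\<lambda>i. sqrt (d i)) ** (adj U ** U) ** diagm (\<lambda>i. 1 / sqrt (d i))"
    by (simp only: R_def R'_def matrix_mul_assoc)
  also have "\<dots> = mat 1"
    by (simp only: U matrix_mul_rid diagm_mult 0 diagm_1)
  finally have 1: "R ** R' = mat 1" .
  have "adj R ** R = U ** (diagm (\<lambda>i. sqrt (d i)) ** diagm (\<lambda>i. sqrt (d i))) ** adj U"
    by (simp add: R_def adj_mult matrix_mul_assoc)
  then have "adj R ** R = G"
    by (simp only: diagm_mult 0 G)
  then show ?thesis using 1 matrix_left_right_inverse by metis
qed

text \<open>Diagonalize the Hermitian matrix \<open>adj R' ** K ** R'\<close> and undo the
  congruence. When \<open>G = adj R ** R\<close>, this diagonalizes \<open>K\<close> relative to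
  \<open>G\<close>, with relative eigenvalues \<open>k\<close>.\<close>

lemma unitary_diag_congruence:
  fixes K R R' :: "complex ^ 'n ^ 'n"
  assumes K: "adj K = K" and R: "R' ** R = mat 1"
  shows "\<exists>(E :: complex ^ 'n ^ 'n) k. adj E ** E = mat 1 \<and> E ** adj E = mat 1 \<and> K = adj R ** (E ** (diagm k ** (adj E ** R)))"
proof -
  have R2: "adj R ** adj R' = mat 1"
    using arg_cong[OF R, of adj] by (simp add: adj_mult)
  have "adj (adj R' ** K ** R') = adj R' ** K ** R'"
    by (simp add: adj_mult K matrix_mul_assoc)
  then obtain E :: "complex ^ 'n ^ 'n" and k where E: "adj E ** E = mat 1" "E ** adj E = mat 1"
    and eq: "adj R' ** K ** R' = E ** diagm k ** adj E"
    using hermitian_diagonalization by metis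
  have "K = (adj R ** adj R') ** K ** (R' ** R)" by (simp add: R R2)
  also have "\<dots> = adj R ** (adj R' ** K ** R') ** R" by (simp only: matrix_mul_assoc)
  finally have "K = adj R ** (E ** (diagm k ** (adj E ** R)))"
    unfolding eq by (simp only: matrix_mul_assoc)
  then show ?thesis using E by blast
qed

lemma cnj_mult_self: "cnj z * z = complex_of_real ((cmod z)\<^sup>2)" "z * cnj z = complex_of_real ((cmod z)\<^sup>2)"
  by (simp_all add: complex_norm_square mult.commute del: of_real_power)

text \<open>Compare diagonal entries in the two unitarity relations. These squared moduli are the
  weights that couple the eigenvalues of two Hermitian matrices with different eigenbases.\<close>

lemma unitary_doubly_stochastic:
  fixes M :: "complex ^ 'n ^ 'n"
  assumes "adj M ** M = mat 1" "M ** adj M = mat 1"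
  shows "(\<Sum>j\<in>UNIV. (cmod (M $ j $ i))\<^sup>2) = 1" "(\<Sum>j\<in>UNIV. (cmod (M $ i $ j))\<^sup>2) = 1"
proof -
  have "complex_of_real (\<Sum>j\<in>UNIV. (cmod (M $ j $ i))\<^sup>2) = (adj M ** M) $ i $ i"
    by (simp add: matrix_matrix_mult_def adj_def cnj_mult_self)
  then show "(\<Sum>j\<in>UNIV. (cmod (M $ j $ i))\<^sup>2) = 1"
    unfolding assms by (simp add: mat_def del: of_real_sum of_real_power)
  have "complex_of_real (\<Sum>j\<in>UNIV. (cmod (M $ i $ j))\<^sup>2) = (M ** adj M) $ i $ i"
    by (simp add: matrix_matrix_mult_def adj_def cnj_mult_self)
  then show "(\<Sum>j\<in>UNIV. (cmod (M $ i $ j))\<^sup>2) = 1"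
    unfolding assms by (simp add: mat_def del: of_real_sum of_real_power)
qed

lemma trace_diagm_congruence:
  fixes M :: "complex ^ 'n ^ 'n"
  shows "trace (diagm k ** (M ** (diagm l ** adj M)))
    = complex_of_real (\<Sum>j\<in>UNIV. k j * (\<Sum>i\<in>UNIV. (cmod (M $ j $ i))\<^sup>2 * l i))"
proof -
  have "(M ** (diagm l ** adj M)) $ j $ j = complex_of_real (\<Sum>i\<in>UNIV. (cmod (M $ j $ i))\<^sup>2 * l i)" for j
  proof -
    have "(M ** (diagm l ** adj M)) $ j $ j = (\<Sum>i\<in>UNIV. M $ j $ i * (diagm l ** adj M) $ i $ j)"
      by (simp only: matrix_matrix_mult_def vec_lambda_beta)
    also have "\<dots> = (\<Sum>i\<in>UNIV. (M $ j $ i * cnj (M $ j $ i)) * complex_of_real (l i))"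
      by (intro sum.cong) (simp_all add: adj_def)
    finally show ?thesis by (simp add: cnj_mult_self)
  qed
  then show ?thesis by (simp add: trace_def)
qed

section \<open>Spectral data of diagonalizable matrices\<close>

lemma map_matrix_const_mult:
  "map_matrix (\<lambda>c. [:c:]) (A ** B) = map_matrix (\<lambda>c. [:c:]) A ** map_matrix (\<lambda>c. [:c:]) (B :: complex ^ 'n ^ 'n)"
proof -
  have "[:sum f X:] = (\<Sum>i\<in>X. [:f i:])" for f :: "'n \<Rightarrow> complex" and X
  proof (induction X rule: infinite_finite_induct)
    case (insert x F)
    from insert.hyps have "[:sum f (insert x F):] = [:f x:] + [:sum f F:]" by simp
    then show ?case by (simp only: insert.IH sum.insert[OF insert.hyps])
  qed auto
  then show ?thesis
    by (simp add: vec_eq_iff matrix_matrix_mult_def mult.commute)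
qed

text \<open>Embed \<open>V\<close> and \<open>V'\<close> as matrices of constant polynomials. Scalar
  matrices are central, so the conjugation extends to the characteristic matrix and the determinants
  of \<open>V\<close> and \<open>V'\<close> cancel.\<close>

lemma char_poly_diagonalizable:
  fixes V V' :: "complex ^ 'n ^ 'n"
  assumes V: "V ** V' = mat 1"
  shows "char_poly (V ** diagm l ** V') = (\<Prod>i\<in>UNIV. [:- complex_of_real (l i), 1:])"
proof -
  let ?C = "map_matrix (\<lambda>c. [:c:]) :: complex ^ 'n ^ 'n \<Rightarrow> complex poly ^ 'n ^ 'n"
  have C1: "?C V ** ?C V' = mat 1"
    by (simp flip: map_matrix_const_mult add: V) (simp add: mat_def vec_eq_iff)
  have comm: "mat x ** A = A ** mat x" for x and A :: "complex poly ^ 'n ^ 'n"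
    by (simp add: mat_def matrix_matrix_mult_def vec_eq_iff if_distrib[of "\<lambda>c. _ * c"]
        if_distrib[of "\<lambda>c. c * _"] mult.commute cong: if_cong)
  have diff_left: "A ** (B - C) = A ** B - A ** C" and diff_right: "(A - B) ** C = A ** C - B ** C"
    for A B C :: "complex poly ^ 'n ^ 'n"
    by (simp_all add: matrix_matrix_mult_def vec_eq_iff left_diff_distrib right_diff_distrib sum_subtractf)
  have "?C V ** (mat [:0, 1:] - ?C (diagm l)) ** ?C V'
      = ?C V ** mat [:0, 1:] ** ?C V' - ?C V ** ?C (diagm l) ** ?C V'"
    by (simp only: diff_left diff_right)
  also have "?C V ** mat [:0, 1:] ** ?C V' = mat [:0, 1:]"
    by (metis C1 comm matrix_mul_assoc matrix_mul_rid)
  also have "?C V ** ?C (diagm l) ** ?C V' = ?C (V ** diagm l ** V')"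
    by (simp add: map_matrix_const_mult)
  finally have "char_poly (V ** diagm l ** V') = det (?C V) * det (mat [:0, 1:] - ?C (diagm l)) * det (?C V')"
    unfolding char_poly_def by (metis det_mul)
  also have "\<dots> = det (?C V ** ?C V') * det (mat [:0, 1:] - ?C (diagm l))"
    by (simp add: det_mul)
  also have "\<dots> = (\<Prod>i\<in>UNIV. [:- complex_of_real (l i), 1:])"
    unfolding C1 det_I mult_1_left by (subst det_diagonal) (simp_all add: mat_def diagm_nth)
  finally show ?thesis .
qed

text \<open>\<open>V\<close> may be any invertible matrix: the matrix in the energy is in general
  not Hermitian, only similar to a Hermitian one.\<close>

lemma trace_fun_diagonalizable:
  fixes V V' :: "complex ^ 'n ^ 'n"
  assumes "V ** V' = mat 1"
  shows "trace_fun g (V ** diagm l ** V') = (\<Sum>i\<in>UNIV. g (l i))"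
proof -
  have "(\<Sum>c\<in>#(\<Sum>i\<in>X. {#complex_of_real (l i)#}). g (Re c)) = (\<Sum>i\<in>X. g (l i))" for X
    by (induction X rule: infinite_finite_induct) auto
  then show ?thesis
    by (simp add: trace_fun_def char_poly_diagonalizable[OF assms] proots_prod)
qed

lemma eigenvalues_diagonalizable:
  fixes V V' :: "complex ^ 'n ^ 'n"
  assumes V: "V ** V' = mat 1"
  shows "eigenvalues (V ** diagm l ** V') = range (\<lambda>i. complex_of_real (l i))"
proof -
  have V': "V' ** V = mat 1" using V by (simp add: matrix_left_right_inverse)
  have scal: "A *v (c *s x) = c *s (A *v x)" for A :: "complex ^ 'n ^ 'n" and c x
    by (simp add: vec.scale)
  show ?thesis
  proof (intro equalityI subsetI)
    fix c assume "c \<in> eigenvalues (V ** diagm l ** V')"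
    then obtain v where v: "v \<noteq> 0" "(V ** diagm l ** V') *v v = c *s v"
      by (auto simp: eigenvalues_def)
    define w where "w = V' *v v"
    have "V *v w = v" by (simp add: w_def matrix_vector_mul_assoc V)
    then have "w \<noteq> 0" using v by auto
    then obtain i where i: "w $ i \<noteq> 0" by (auto simp: vec_eq_iff)
    have "diagm l *v w = V' *v ((V ** diagm l ** V') *v v)"
      by (simp add: w_def matrix_vector_mul_assoc matrix_mul_assoc V')
    also have "\<dots> = c *s w" by (simp add: v scal w_def)
    finally have "complex_of_real (l i) * w $ i = c * w $ i"
      by (metis diagm_vec_nth vector_smult_component)
    then show "c \<in> range (\<lambda>i. complex_of_real (l i))" using i by auto
  next
    fix c assume "c \<in> range (\<lambda>i. complex_of_real (l i))"
    then obtain i where c: "c = complex_of_real (l i)" by auto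
    define v where "v = V *v axis i 1"
    have 1: "V' *v v = axis i 1" by (simp add: v_def matrix_vector_mul_assoc V')
    then have "v \<noteq> 0" by (metis axis_eq_0_iff matrix_vector_mult_0_right zero_neq_one)
    moreover have "diagm l *v axis i 1 = c *s axis i 1"
      by (simp add: vec_eq_iff diagm_vec_nth c axis_def)
    then have "(V ** diagm l ** V') *v v = c *s v"
      by (simp add: 1 scal v_def flip: matrix_vector_mul_assoc) (simp add: 1 scal flip: v_def)
    ultimately show "c \<in> eigenvalues (V ** diagm l ** V')"
      by (auto simp: eigenvalues_def)
  qed
qed

section \<open>Affine minorants of the integrand\<close>

lemma ln_support_bound:
  fixes w s :: real
  assumes w: "w \<ge> 1" and s: "0 \<le> s"
  shows "ln w - w / 2 + (1 - s\<^sup>2) / (2 * w) + 1 \<le> 1 - s + ln (1 + s)"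
proof -
  define d where "d = (\<lambda>w. ln w - w / 2 + (1 - s\<^sup>2) / (2 * w))"
  \<comment> \<open>\<open>d\<close> increases between \<open>1 - s\<close> and \<open>1 + s\<close>
    and decreases afterwards, so \<open>1 + s\<close> is its maximum over \<open>w \<ge> 1\<close>.
    The condition \<open>w \<ge> 1\<close> excludes the branch below \<open>1 - s\<close>, where
    \<open>d\<close> decreases and, for \<open>s < 1\<close>, blows up at 0.\<close>
  have der: "(d has_real_derivative - ((x - 1)\<^sup>2 - s\<^sup>2) / (2 * x\<^sup>2)) (at x)" if "x > 0" for x
    unfolding d_def using that
    by (auto intro!: derivative_eq_intros simp: field_simps power2_eq_square)
  have "d w \<le> d (1 + s)"
  proof (cases "w \<le> 1 + s")
    case True
    show ?thesis
    proof (rule DERIV_nonneg_imp_nondecreasing[OF True])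
      fix x assume x: "w \<le> x" "x \<le> 1 + s"
      then have "(x - 1)\<^sup>2 \<le> s\<^sup>2" using w by (intro power_mono) auto
      then show "\<exists>y. DERIV d x :> y \<and> 0 \<le> y"
        using x w der[of x] by (intro exI conjI) (auto simp: divide_nonpos_pos)
    qed
  next
    case False
    then have "1 + s \<le> w" by simp
    then show ?thesis
    proof (rule DERIV_nonpos_imp_nonincreasing)
      fix x assume x: "1 + s \<le> x" "x \<le> w"
      then have "s\<^sup>2 \<le> (x - 1)\<^sup>2" using s by (intro power_mono) auto
      then show "\<exists>y. DERIV d x :> y \<and> y \<le> 0"
        using x s der[of x] by (intro exI conjI) (auto intro!: divide_nonpos_nonneg)
    qed
  qed
  also have "d (1 + s) = ln (1 + s) - s"
    using s by (simp add: d_def field_simps power2_eq_square)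
  finally show ?thesis by (simp add: d_def)
qed

text \<open>Put \<open>w = 1 / k\<close> and \<open>s = sqrt (1 - q)\<close> in the scalar bound.
  Its condition \<open>w \<ge> 1\<close> becomes \<open>k \<le> 1\<close>, which will express that
  \<open>K\<close> is at most \<open>G\<close>.\<close>

lemma HK_f_ge:
  assumes "0 < k" "k \<le> 1" "0 \<le> q" "q \<le> 1"
  shows "- ln k - 1 / (2 * k) + k / 2 * q + 1 \<le> HK_f q"
  using ln_support_bound[of "1 / k" "sqrt (1 - q)"] assms
  by (simp add: HK_f_def ln_div algebra_simps)

text \<open>The maximizer \<open>w = 1 + s\<close> corresponds to \<open>k = 1 / (1 + s)\<close>; as
  \<open>q = (1 - s) * (1 + s)\<close>, the term with \<open>q\<close> reduces to
  \<open>(1 - s) / 2\<close>.\<close>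

lemma HK_f_eq:
  assumes "q \<le> 1"
  shows "- ln (1 / (1 + sqrt (1 - q))) - 1 / (2 * (1 / (1 + sqrt (1 - q))))
     + (1 / (1 + sqrt (1 - q))) / 2 * q + 1 = HK_f q"
proof -
  define s where "s = sqrt (1 - q)"
  have s: "s \<ge> 0" "q = 1 - s\<^sup>2" using assms by (auto simp: s_def)
  have "1 + s > 0" using s by simp
  then have "1 / (1 + s) / 2 * q = (1 - s) / 2"
    unfolding s by (simp add: field_simps power2_eq_square)
  then show ?thesis
    using s(1) unfolding HK_f_def s_def[symmetric] by (simp add: ln_div field_simps)
qed

section \<open>Matrix supports through simultaneous diagonalization\<close>

definition HK_mat :: "complex ^ 'n ^ 'n \<Rightarrow> complex ^ 'n ^ 'n \<Rightarrow> complex ^ 'n ^ 'n" where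
  "HK_mat \<xi> G = \<xi> ** G ** map_matrix cnj \<xi> ** G"

text \<open>\<open>HK_mat \<xi> G\<close> is similar through \<open>R\<close> to a matrix of the
  form \<open>S ** adj S\<close>, which has a unitary eigenbasis and nonnegative eigenvalues.
  Symmetry of \<open>\<xi>\<close> enters by identifying its conjugate with its adjoint.\<close>

lemma HK_mat_diagonalization:
  fixes G \<xi> :: "complex ^ 'n ^ 'n"
  assumes G: "herm_pd G" and Gr: "map_matrix cnj G = G" and \<xi>: "transpose \<xi> = \<xi>"
  obtains R R' U :: "complex ^ 'n ^ 'n" and l where
    "R' ** R = mat 1" "R ** R' = mat 1" "G = adj R ** R"
    "adj U ** U = mat 1" "U ** adj U = mat 1"
    "R ** \<xi> ** G ** adj \<xi> ** adj R = U ** diagm l ** adj U"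
    "HK_mat \<xi> G = (R' ** U) ** diagm l ** (adj U ** R)"
    "(R' ** U) ** (adj U ** R) = mat 1"
    "\<And>i. 0 \<le> l i"
proof -
  obtain R R' :: "complex ^ 'n ^ 'n" where R: "R' ** R = mat 1" "R ** R' = mat 1" and GR: "G = adj R ** R"
    using herm_pd_factorization[OF G] by blast
  \<comment> \<open>Since \<open>G\<close> is real, conjugating \<open>G = adj R ** R\<close> yields
    a second factorization; it is the middle factor of \<open>S ** adj S\<close>.\<close>
  have GT: "G = transpose R ** transpose (adj R)"
    by (metis GR Gr adj_adj adj_mult matrix_transpose_mul transpose_adj)
  have \<xi>a: "map_matrix cnj \<xi> = adj \<xi>"
    by (metis \<xi> adj_transpose)
  define S where "S = R ** \<xi> ** transpose R"
  have SS: "S ** adj S = R ** \<xi> ** G ** adj \<xi> ** adj R"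
    unfolding S_def GT by (simp add: adj_mult adj_transpose transpose_adj matrix_mul_assoc)
  have "adj (S ** adj S) = S ** adj S" by (simp add: adj_mult)
  then obtain U :: "complex ^ 'n ^ 'n" and l where U: "adj U ** U = mat 1" "U ** adj U = mat 1"
    and eq: "S ** adj S = U ** diagm l ** adj U"
    using hermitian_diagonalization by blast
  have l: "0 \<le> l i" for i
  proof -
    define x where "x = U *v axis i 1"
    have "l i = x \<bullet> ((S ** adj S) *v x)"
      unfolding x_def eq using diag_entry_inner(2)[OF U(1), of i l] by simp
    also have "\<dots> = (adj S *v x) \<bullet> (adj S *v x)"
      by (simp add: inner_adj flip: matrix_vector_mul_assoc)
    finally show ?thesis by simp
  qed
  have "HK_mat \<xi> G = \<xi> ** G ** adj \<xi> ** adj R ** R"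
    by (simp add: HK_mat_def \<xi>a matrix_mul_assoc GR)
  also have "\<dots> = R' ** (R ** \<xi> ** G ** adj \<xi> ** adj R) ** R"
    by (simp add: matrix_mul_assoc R)
  also have "\<dots> = (R' ** U) ** diagm l ** (adj U ** R)"
    unfolding SS[symmetric] eq by (simp only: matrix_mul_assoc)
  finally have 1: "HK_mat \<xi> G = (R' ** U) ** diagm l ** (adj U ** R)" .
  have "(R' ** U) ** (adj U ** R) = R' ** (U ** adj U) ** R" by (simp only: matrix_mul_assoc)
  then have 2: "(R' ** U) ** (adj U ** R) = mat 1" by (simp add: U R)
  show thesis
    using that[OF R GR U _ 1 2 l] SS eq by simp
qed

text \<open>\<open>P\<close> stands for the inverse of \<open>K\<close>.\<close>

definition HK_support :: "complex ^ 'n ^ 'n \<Rightarrow> complex ^ 'n ^ 'n \<Rightarrow> complex ^ 'n ^ 'n \<Rightarrow> complex ^ 'n ^ 'n \<Rightarrow> real" where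
  "HK_support \<xi> K P G = - ln (Re (det K)) - Re (trace (P ** G)) / 2
     + Re (trace (K ** \<xi> ** G ** adj \<xi>)) / 2 + CARD('n)"

text \<open>In the coordinates given by \<open>R\<close>, \<open>G\<close> becomes the identity and
  \<open>K\<close> becomes \<open>E ** diagm k ** adj E\<close>. The relative determinant and the
  trace with \<open>P\<close> then depend on \<open>k\<close> only, while the trace with
  \<open>\<xi>\<close> couples the eigenbases through \<open>adj E ** U\<close>. The dimension is
  distributed as a 1 in each summand.\<close>

lemma HK_support_diag:
  fixes G \<xi> R R' U E K P :: "complex ^ 'n ^ 'n"
  assumes R: "R' ** R = mat 1" "R ** R' = mat 1" and G: "G = adj R ** R"
    and E: "adj E ** E = mat 1" "E ** adj E = mat 1"
    and S: "R ** \<xi> ** G ** adj \<xi> ** adj R = U ** diagm l ** adj U"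
    and K: "K = adj R ** E ** diagm k ** adj E ** R" and P: "P ** K = mat 1"
    and k: "\<And>i. 0 < k i"
  shows "HK_support \<xi> K P G = - ln (Re (det G)) +
     (\<Sum>j\<in>UNIV. - ln (k j) - 1 / (2 * k j) + k j / 2 * (\<Sum>i\<in>UNIV. (cmod ((adj E ** U) $ j $ i))\<^sup>2 * l i) + 1)"
proof -
  have aR: "adj R ** adj R' = mat 1" "adj R' ** adj R = mat 1"
    using R by (metis adj_mult adj_mat1)+
  have E1: "det (adj E) * det E = 1" by (metis E(1) det_I det_mul)
  have "det K = det (adj R) * det R * det (diagm k) * (det (adj E) * det E)"
    unfolding K det_mul by (simp only: mult_ac)
  then have "det K = det (adj R) * det R * det (diagm k)"
    unfolding E1 by simp
  also have "\<dots> = complex_of_real ((cmod (det R))\<^sup>2 * (\<Prod>i\<in>UNIV. k i))"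
    unfolding det_adj cnj_mult_self det_diagm by simp
  finally have "Re (det K) = (cmod (det R))\<^sup>2 * (\<Prod>i\<in>UNIV. k i)" by (simp del: of_real_prod of_real_mult)
  moreover have "Re (det G) = (cmod (det R))\<^sup>2"
    unfolding G det_mul det_adj cnj_mult_self by (simp del: of_real_power)
  moreover have "det R \<noteq> 0" using R invertible_det_nz unfolding invertible_def by blast
  ultimately have 1: "ln (Re (det K)) = ln (Re (det G)) + (\<Sum>i\<in>UNIV. ln (k i))"
    using k by (simp add: ln_mult prod_pos ln_prod less_imp_neq[THEN not_sym])
  \<comment> \<open>The inverse of \<open>K\<close> in the same coordinates; uniqueness of inverses
    identifies it with \<open>P\<close>.\<close>
  define P' where "P' = R' ** E ** diagm (\<lambda>i. 1 / k i) ** adj E ** adj R'"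
  have "K ** P' = adj R ** E ** diagm k ** (adj E ** (R ** R') ** E) ** diagm (\<lambda>i. 1 / k i) ** adj E ** adj R'"
    unfolding K P'_def by (simp only: matrix_mul_assoc)
  also have "\<dots> = adj R ** E ** (diagm k ** diagm (\<lambda>i. 1 / k i)) ** adj E ** adj R'"
    by (simp add: R E matrix_mul_assoc)
  also have "diagm k ** diagm (\<lambda>i. 1 / k i) = mat 1"
    using k by (simp add: diagm_mult less_imp_neq[THEN not_sym] diagm_1)
  also have "adj R ** E ** mat 1 ** adj E ** adj R' = adj R ** (E ** adj E) ** adj R'"
    by (simp add: matrix_mul_assoc)
  also have "\<dots> = mat 1" by (simp add: E aR)
  finally have "P = P'" using P by (metis matrix_mul_assoc matrix_mul_lid matrix_mul_rid)
  then have "trace (P ** G) = trace (R' ** (E ** diagm (\<lambda>i. 1 / k i) ** adj E ** (adj R' ** adj R) ** R))"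
    unfolding P'_def G by (simp only: matrix_mul_assoc)
  also have "\<dots> = trace (E ** diagm (\<lambda>i. 1 / k i) ** adj E ** R ** R')"
    by (subst trace_mul_sym) (simp add: aR)
  also have "\<dots> = trace (E ** (diagm (\<lambda>i. 1 / k i) ** adj E ** (R ** R')))"
    by (simp only: matrix_mul_assoc)
  also have "\<dots> = trace (diagm (\<lambda>i. 1 / k i) ** (adj E ** E))"
    by (subst trace_mul_sym) (simp add: R matrix_mul_assoc)
  finally have 2: "Re (trace (P ** G)) = (\<Sum>i\<in>UNIV. 1 / k i)"
    by (simp add: E trace_diagm)
  have "trace (K ** \<xi> ** G ** adj \<xi>) = trace ((adj R ** E) ** (diagm k ** adj E ** R ** \<xi> ** G ** adj \<xi>))"
    unfolding K by (simp only: matrix_mul_assoc)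
  also have "\<dots> = trace (diagm k ** adj E ** (R ** \<xi> ** G ** adj \<xi> ** adj R) ** E)"
    by (subst trace_mul_sym) (simp only: matrix_mul_assoc)
  also have "\<dots> = trace (diagm k ** ((adj E ** U) ** (diagm l ** adj (adj E ** U))))"
    unfolding S adj_mult adj_adj by (simp only: matrix_mul_assoc)
  finally have 3: "Re (trace (K ** \<xi> ** G ** adj \<xi>))
      = (\<Sum>j\<in>UNIV. k j * (\<Sum>i\<in>UNIV. (cmod ((adj E ** U) $ j $ i))\<^sup>2 * l i))"
    unfolding trace_diagm_congruence by (simp only: Re_complex_of_real)
  show ?thesis
    unfolding HK_support_def 1 2 3
    by (simp add: sum.distrib sum_subtractf sum_negf sum_divide_distrib mult.commute)
qed

lemma inner_congruence: "x \<bullet> ((adj R ** M ** R) *v x) = (R *v x) \<bullet> (M *v (R *v x))"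
  by (simp add: inner_adj flip: matrix_vector_mul_assoc)

lemma diagonalization_spectral_bound:
  fixes V V' :: "complex ^ 'n ^ 'n"
  assumes "V ** V' = mat 1" "spectral_radius (V ** diagm l ** V') < 1"
  shows "l i < 1"
proof -
  have "cmod (complex_of_real (l i)) \<le> spectral_radius (V ** diagm l ** V')"
    unfolding spectral_radius_def eigenvalues_diagonalizable[OF assms(1)]
    by (intro Max_ge imageI rangeI) auto
  then show ?thesis using assms(2) by simp
qed

text \<open>Since \<open>K\<close> is at most \<open>G\<close>, its relative eigenvalues lie in
  \<open>(0,1]\<close>. The doubly stochastic weights turn the coupled trace into an average over
  pairs \<open>k j\<close>, \<open>l i\<close>, and \<open>HK_f_ge\<close> applies to each
  pair.\<close>

lemma HK_support_le:
  fixes G \<xi> K P :: "complex ^ 'n ^ 'n"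
  assumes G: "herm_pd G" and Gr: "map_matrix cnj G = G" and \<xi>: "transpose \<xi> = \<xi>"
    and r: "spectral_radius (HK_mat \<xi> G) < 1"
    and K: "herm_pd K" and KG: "\<And>x. x \<bullet> (K *v x) \<le> x \<bullet> (G *v x)" and P: "P ** K = mat 1"
  shows "HK_support \<xi> K P G \<le> - ln (Re (det G)) + HK_rho (HK_mat \<xi> G)"
proof -
  obtain R R' U :: "complex ^ 'n ^ 'n" and l where R: "R' ** R = mat 1" "R ** R' = mat 1" and GR: "G = adj R ** R"
    and U: "adj U ** U = mat 1" "U ** adj U = mat 1"
    and S: "R ** \<xi> ** G ** adj \<xi> ** adj R = U ** diagm l ** adj U"
    and A: "HK_mat \<xi> G = (R' ** U) ** diagm l ** (adj U ** R)"
    and inv: "(R' ** U) ** (adj U ** R) = mat 1"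
    and l0: "\<And>i. 0 \<le> l i"
    by (rule HK_mat_diagonalization[OF G Gr \<xi>], rule that)
  have l1: "l i < 1" for i
    using diagonalization_spectral_bound[OF inv] r unfolding A by blast
  obtain E :: "complex ^ 'n ^ 'n" and k where E: "adj E ** E = mat 1" "E ** adj E = mat 1"
    and K': "K = adj R ** (E ** (diagm k ** (adj E ** R)))"
    using unitary_diag_congruence[OF _ R(1)] K unfolding herm_pd_def by blast
  then have KE: "K = adj R ** (E ** diagm k ** adj E) ** R" by (simp only: matrix_mul_assoc)
  have k: "0 < k j \<and> k j \<le> 1" for j
  proof -
    \<comment> \<open>In this common eigendirection the form of \<open>G\<close> is 1 and that of
      \<open>K\<close> is \<open>k j\<close>.\<close>
    define x where "x = R' *v (E *v axis j 1)"
    have Rx: "R *v x = E *v axis j 1"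
      by (simp add: x_def matrix_vector_mul_assoc matrix_mul_assoc R)
    then have "x \<noteq> 0" using diag_entry_inner(1)[OF E(1), of j] by auto
    moreover have "x \<bullet> (K *v x) = k j"
      unfolding KE inner_congruence Rx using diag_entry_inner(2)[OF E(1), of j k] by simp
    moreover have "x \<bullet> (G *v x) = 1"
    proof -
      have "x \<bullet> (G *v x) = x \<bullet> ((adj R ** (E ** diagm (\<lambda>i. 1) ** adj E) ** R) *v x)"
        by (simp add: diagm_1 E GR)
      then show ?thesis
        unfolding inner_congruence Rx using diag_entry_inner(2)[OF E(1), of j "\<lambda>i. 1"] by simp
    qed
    ultimately show ?thesis using K KG[of x] unfolding herm_pd_def by auto
  qed
  define p where "p j i = (cmod ((adj E ** U) $ j $ i))\<^sup>2" for j i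
  have "adj (adj E ** U) ** (adj E ** U) = adj U ** (E ** adj E) ** U"
       "(adj E ** U) ** adj (adj E ** U) = adj E ** (U ** adj U) ** E"
    by (simp_all only: adj_mult adj_adj matrix_mul_assoc)
  then have EU: "adj (adj E ** U) ** (adj E ** U) = mat 1" "(adj E ** U) ** adj (adj E ** U) = mat 1"
    by (simp_all add: E U)
  have p: "(\<Sum>j\<in>UNIV. p j i) = 1" "(\<Sum>i\<in>UNIV. p j i) = 1" for i j
    unfolding p_def using unitary_doubly_stochastic[OF EU] by auto
  have "HK_support \<xi> K P G = - ln (Re (det G)) +
     (\<Sum>j\<in>UNIV. - ln (k j) - 1 / (2 * k j) + k j / 2 * (\<Sum>i\<in>UNIV. p j i * l i) + 1)"
    unfolding p_def
    by (rule HK_support_diag[OF R GR E S _ P]) (use k KE in \<open>auto simp: matrix_mul_assoc\<close>)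
  \<comment> \<open>Each row of \<open>p\<close> sums to 1, so the terms independent of
    \<open>i\<close> may be spread over the row. After the scalar bound and a swap of the sums, the
    column sums remove the weights again.\<close>
  also have "(\<Sum>j\<in>UNIV. - ln (k j) - 1 / (2 * k j) + k j / 2 * (\<Sum>i\<in>UNIV. p j i * l i) + 1)
      = (\<Sum>j\<in>UNIV. \<Sum>i\<in>UNIV. p j i * (- ln (k j) - 1 / (2 * k j) + k j / 2 * l i + 1))"
  proof (rule sum.cong[OF refl])
    fix j
    have "(\<Sum>i\<in>UNIV. p j i * (- ln (k j) - 1 / (2 * k j) + k j / 2 * l i + 1))
       = (\<Sum>i\<in>UNIV. p j i * (- ln (k j) - 1 / (2 * k j) + 1) + k j / 2 * (p j i * l i))"
      by (intro sum.cong) (auto simp: algebra_simps)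
    also have "\<dots> = (- ln (k j) - 1 / (2 * k j) + 1) + k j / 2 * (\<Sum>i\<in>UNIV. p j i * l i)"
      unfolding sum.distrib sum_distrib_right[symmetric] sum_distrib_left[symmetric] p by simp
    finally show "- ln (k j) - 1 / (2 * k j) + k j / 2 * (\<Sum>i\<in>UNIV. p j i * l i) + 1
      = (\<Sum>i\<in>UNIV. p j i * (- ln (k j) - 1 / (2 * k j) + k j / 2 * l i + 1))" by simp
  qed
  also have "\<dots> \<le> (\<Sum>j\<in>UNIV. \<Sum>i\<in>UNIV. p j i * HK_f (l i))"
    using k l0 l1 by (intro sum_mono mult_left_mono HK_f_ge) (auto simp: p_def less_imp_le)
  also have "\<dots> = (\<Sum>i\<in>UNIV. \<Sum>j\<in>UNIV. p j i * HK_f (l i))" by (rule sum.swap)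
  also have "\<dots> = (\<Sum>i\<in>UNIV. HK_f (l i))"
    by (simp add: p flip: sum_distrib_right)
  also have "\<dots> = HK_rho (HK_mat \<xi> G)"
    unfolding HK_rho_def A trace_fun_diagonalizable[OF inv] ..
  finally show ?thesis by simp
qed

text \<open>Equality is reached by giving \<open>K\<close> the eigenbasis \<open>U\<close> itself,
  so that the coupling weights form the identity, and by choosing each \<open>k i\<close> as the
  optimizer of the scalar inequality at \<open>l i\<close>.\<close>

lemma HK_support_attained:
  fixes G \<xi> :: "complex ^ 'n ^ 'n"
  assumes G: "herm_pd G" and Gr: "map_matrix cnj G = G" and \<xi>: "transpose \<xi> = \<xi>"
    and r: "spectral_radius (HK_mat \<xi> G) < 1"
  shows "\<exists>K P. herm_pd K \<and> (\<forall>x. x \<noteq> 0 \<longrightarrow> x \<bullet> (K *v x) < x \<bullet> (G *v x)) \<and> P ** K = mat 1 \<and>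
    HK_support \<xi> K P G = - ln (Re (det G)) + HK_rho (HK_mat \<xi> G)"
proof -
  obtain R R' U :: "complex ^ 'n ^ 'n" and l where R: "R' ** R = mat 1" "R ** R' = mat 1" and GR: "G = adj R ** R"
    and U: "adj U ** U = mat 1" "U ** adj U = mat 1"
    and S: "R ** \<xi> ** G ** adj \<xi> ** adj R = U ** diagm l ** adj U"
    and A: "HK_mat \<xi> G = (R' ** U) ** diagm l ** (adj U ** R)"
    and inv: "(R' ** U) ** (adj U ** R) = mat 1"
    and l0: "\<And>i. 0 \<le> l i"
    by (rule HK_mat_diagonalization[OF G Gr \<xi>], rule that)
  have l1: "l i < 1" for i
    using diagonalization_spectral_bound[OF inv] r unfolding A by blast
  define k where "k i = 1 / (1 + sqrt (1 - l i))" for i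
  \<comment> \<open>\<open>l i < 1\<close> makes the square root positive, hence
    \<open>k i < 1\<close> strictly; this is the gap between \<open>K\<close> and \<open>G\<close>
    that absorbs perturbations of \<open>G\<close>.\<close>
  have k: "0 < k i" "k i < 1" for i
    unfolding k_def using l1[of i] by (auto simp: divide_simps add_pos_pos)
  define K where "K = adj R ** (U ** diagm k ** adj U) ** R"
  define P where "P = R' ** U ** diagm (\<lambda>i. 1 / k i) ** adj U ** adj R'"
  have aR: "adj R' ** adj R = mat 1"
    using R by (metis adj_mult adj_mat1)
  have diag: "x \<bullet> ((adj R ** (U ** diagm d ** adj U) ** R) *v x)
      = (\<Sum>i\<in>UNIV. d i * (cmod ((adj U *v (R *v x)) $ i))\<^sup>2)" for d x
    unfolding inner_congruence inner_diagm_congruence ..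
  have nz: "\<exists>i. (adj U *v (R *v x)) $ i \<noteq> 0" if "x \<noteq> 0" for x
  proof -
    have "(R' ** U) *v (adj U *v (R *v x)) = x"
      using inv by (simp add: matrix_vector_mul_assoc matrix_mul_assoc)
    then have "adj U *v (R *v x) \<noteq> 0" using that by auto
    then show ?thesis by (auto simp: vec_eq_iff)
  qed
  have pos: "0 < (\<Sum>i\<in>UNIV. d i * (cmod ((adj U *v (R *v x)) $ i))\<^sup>2)"
    if "x \<noteq> 0" "\<And>i. 0 < d i" for x d
  proof -
    obtain i where "(adj U *v (R *v x)) $ i \<noteq> 0" using nz \<open>x \<noteq> 0\<close> by blast
    then show ?thesis using that(2) by (intro sum_pos2[of _ i]) (auto simp: less_imp_le)
  qed
  have "adj K = K" by (simp add: K_def adj_mult matrix_mul_assoc)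
  then have 1: "herm_pd K"
    unfolding herm_pd_def K_def diag using pos k by blast
  have "x \<bullet> (K *v x) < x \<bullet> (G *v x)" if "x \<noteq> 0" for x
  proof -
    have "G = adj R ** (U ** diagm (\<lambda>i. 1) ** adj U) ** R" by (simp add: diagm_1 U GR)
    then have "x \<bullet> (G *v x) - x \<bullet> (K *v x) = (\<Sum>i\<in>UNIV. (1 - k i) * (cmod ((adj U *v (R *v x)) $ i))\<^sup>2)"
      unfolding K_def using diag[of x k] diag[of x "\<lambda>i. 1"]
      by (simp add: left_diff_distrib sum_subtractf)
    then show ?thesis using pos[OF that, of "\<lambda>i. 1 - k i"] k by simp
  qed
  moreover have 2: "P ** K = mat 1"
  proof -
    have "P ** K = R' ** U ** diagm (\<lambda>i. 1 / k i) ** (adj U ** (adj R' ** adj R) ** U) ** diagm k ** adj U ** R"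
      unfolding P_def K_def by (simp only: matrix_mul_assoc)
    also have "\<dots> = R' ** U ** (diagm (\<lambda>i. 1 / k i) ** diagm k) ** adj U ** R"
      by (simp add: aR U matrix_mul_assoc)
    also have "diagm (\<lambda>i. 1 / k i) ** diagm k = mat 1"
      using k by (simp add: diagm_mult less_imp_neq[THEN not_sym] diagm_1)
    finally show ?thesis using inv by (simp add: matrix_mul_assoc)
  qed
  moreover have "HK_support \<xi> K P G = - ln (Re (det G)) + HK_rho (HK_mat \<xi> G)"
  proof -
    have UU: "(\<Sum>i\<in>UNIV. (cmod ((adj U ** U) $ j $ i))\<^sup>2 * l i) = l j" for j
    proof -
      have "(\<Sum>i\<in>UNIV. (cmod ((adj U ** U) $ j $ i))\<^sup>2 * l i) = (\<Sum>i\<in>UNIV. if i = j then l i else 0)"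
        unfolding U by (intro sum.cong) (auto simp: mat_def)
      then show ?thesis by simp
    qed
    have "HK_support \<xi> K P G = - ln (Re (det G)) +
      (\<Sum>j\<in>UNIV. - ln (k j) - 1 / (2 * k j) + k j / 2 * (\<Sum>i\<in>UNIV. (cmod ((adj U ** U) $ j $ i))\<^sup>2 * l i) + 1)"
      by (rule HK_support_diag[OF R GR U S _ 2]) (use k in \<open>auto simp: K_def matrix_mul_assoc\<close>)
    also have "\<dots> = - ln (Re (det G)) + (\<Sum>j\<in>UNIV. HK_f (l j))"
      unfolding UU k_def
      by (intro arg_cong2[of _ _ _ _ "(+)"] sum.cong refl HK_f_eq) (use l1 in \<open>simp add: less_imp_le\<close>)
    also have "(\<Sum>j\<in>UNIV. HK_f (l j)) = HK_rho (HK_mat \<xi> G)"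
      unfolding HK_rho_def A trace_fun_diagonalizable[OF inv] ..
    finally show ?thesis .
  qed
  ultimately show ?thesis using 1 by blast
qed

section \<open>Local affine supports at real matrices\<close>

lemma quadratic_form_perturbation:
  fixes f g :: "'a::euclidean_space \<Rightarrow> 'a"
  assumes f: "linear f" and g: "linear g" and pos: "\<And>x. x \<noteq> 0 \<Longrightarrow> 0 < x \<bullet> f x"
  shows "\<exists>e>0. \<forall>h x. \<bar>h\<bar> < e \<longrightarrow> 0 \<le> x \<bullet> f x + h * (x \<bullet> g x)"
proof -
  have "compact (sphere (0::'a) 1)" "sphere (0::'a) 1 \<noteq> {}" by auto
  moreover have "continuous_on (sphere 0 1) (\<lambda>x. x \<bullet> f x)"
    using f by (intro continuous_intros linear_continuous_on) (auto simp: linear_conv_bounded_linear)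
  ultimately obtain x0 where x0: "norm x0 = 1" and min: "\<And>x. norm x = 1 \<Longrightarrow> x0 \<bullet> f x0 \<le> x \<bullet> f x"
    using continuous_attains_inf[of "sphere 0 1" "\<lambda>x. x \<bullet> f x"] by (metis dist_0_norm mem_sphere)
  \<comment> \<open>The minimum over the compact sphere: by homogeneity the first form is at least
    \<open>\<delta> * (norm x)\<^sup>2\<close>. The second is at most
    \<open>C * (norm x)\<^sup>2\<close> in absolute value, whence the radius
    \<open>\<delta> / C\<close>.\<close>
  define \<delta> where "\<delta> = x0 \<bullet> f x0"
  have "\<delta> > 0" unfolding \<delta>_def using x0 by (intro pos) auto
  have low: "\<delta> * (norm x)\<^sup>2 \<le> x \<bullet> f x" for x
  proof (cases "x = 0")
    case False
    have "\<delta> \<le> ((1 / norm x) *\<^sub>R x) \<bullet> f ((1 / norm x) *\<^sub>R x)"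
      unfolding \<delta>_def using False by (intro min) simp
    also have "\<dots> = (x \<bullet> f x) / (norm x)\<^sup>2"
      using f by (simp add: linear_scale power2_eq_square)
    finally show ?thesis using False by (simp add: field_simps)
  qed simp
  obtain C where C: "C > 0" "\<And>x. norm (g x) \<le> C * norm x"
    using linear_bounded_pos[OF g] by blast
  have "0 \<le> x \<bullet> f x + h * (x \<bullet> g x)" if "\<bar>h\<bar> < \<delta> / C" for h x
  proof -
    have "\<bar>h * (x \<bullet> g x)\<bar> \<le> \<bar>h\<bar> * (norm x * norm (g x))"
      by (simp add: abs_mult mult_left_mono Cauchy_Schwarz_ineq2)
    also have "\<dots> \<le> (\<delta> / C) * (norm x * (C * norm x))"
      using that C \<open>\<delta> > 0\<close> by (intro mult_mono mult_left_mono) auto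
    also have "\<dots> = \<delta> * (norm x)\<^sup>2" using C by (simp add: power2_eq_square)
    also have "\<dots> \<le> x \<bullet> f x" by (rule low)
    finally show ?thesis by linarith
  qed
  then show ?thesis using \<open>\<delta> > 0\<close> C by (intro exI[of _ "\<delta> / C"]) auto
qed

abbreviation cmat :: "real ^ 'n ^ 'm \<Rightarrow> complex ^ 'n ^ 'm" where
  "cmat \<equiv> map_matrix complex_of_real"

lemma det_cmat: "det (cmat A) = complex_of_real (det A)"
  by (simp add: det_def)

text \<open>For real \<open>G\<close> the form splits into its values on the real and imaginary
  parts of the vector, at least one of which is nonzero.\<close>

lemma herm_pd_cmat:
  fixes G :: "real ^ 'n ^ 'n"
  assumes "pos_definite G"
  shows "herm_pd (cmat G)"
proof -
  have "transpose G = G" using assms by (simp add: pos_definite_def)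
  then have "G $ j $ i = G $ i $ j" for i j
    by (simp add: transpose_def vec_eq_iff)
  then have "adj (cmat G) = cmat G" by (simp add: adj_def vec_eq_iff)
  moreover have "0 < x \<bullet> (cmat G *v x)" if "x \<noteq> 0" for x
  proof -
    define a where "a = (\<chi> i. Re (x $ i))"
    define b where "b = (\<chi> i. Im (x $ i))"
    have "x \<bullet> (cmat G *v x) = a \<bullet> (G *v a) + b \<bullet> (G *v b)"
      by (simp add: inner_vec_def inner_complex_def matrix_vector_mult_def a_def b_def sum.distrib)
    moreover have "a \<noteq> 0 \<or> b \<noteq> 0"
      using that by (auto simp: a_def b_def vec_eq_iff complex_eq_iff)
    moreover have "0 \<le> v \<bullet> (G *v v)" "v \<noteq> 0 \<Longrightarrow> 0 < v \<bullet> (G *v v)" for v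
      using assms unfolding pos_definite_def by (cases "v = 0"; auto simp: less_imp_le)+
    ultimately show ?thesis by (metis add_nonneg_pos add_pos_nonneg)
  qed
  ultimately show ?thesis by (simp add: herm_pd_def)
qed

lemma pos_definite_det:
  fixes G :: "real ^ 'n ^ 'n"
  assumes "pos_definite G"
  shows "0 < det G"
proof -
  obtain R R' :: "complex ^ 'n ^ 'n" where R: "R' ** R = mat 1" "R ** R' = mat 1" "cmat G = adj R ** R"
    using herm_pd_factorization[OF herm_pd_cmat[OF assms]] by blast
  have "complex_of_real (det G) = complex_of_real ((cmod (det R))\<^sup>2)"
    unfolding det_cmat[symmetric] R(3) det_mul det_adj cnj_mult_self ..
  then have "det G = (cmod (det R))\<^sup>2" by (simp only: of_real_eq_iff)
  moreover have "det R \<noteq> 0" using R(1,2) invertible_det_nz unfolding invertible_def by blast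
  ultimately show ?thesis by simp
qed

lemma matrix_mult_scaleR_right: "(A :: complex ^ 'n ^ 'm) ** (s *\<^sub>R B) = s *\<^sub>R (A ** B)"
  by (simp add: vec_eq_iff matrix_matrix_mult_def scaleR_sum_right)

lemma matrix_mult_scaleR_left: "(s *\<^sub>R A :: complex ^ 'n ^ 'm) ** B = s *\<^sub>R (A ** B)"
  by (simp add: vec_eq_iff matrix_matrix_mult_def scaleR_sum_right)

lemma trace_scaleR: "trace (s *\<^sub>R (A :: complex ^ 'n ^ 'n)) = s *\<^sub>R trace A"
  by (simp add: trace_def scaleR_sum_right)

lemma HK_support_affine:
  fixes \<xi> K P X Y :: "complex ^ 'n ^ 'n"
  shows "HK_support \<xi> K P (X + s *\<^sub>R Y) = HK_support \<xi> K P X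
     + (Re (trace (K ** \<xi> ** Y ** adj \<xi>)) / 2 - Re (trace (P ** Y)) / 2) * s"
proof -
  have add_left: "(A + B) ** C = A ** C + B ** C" for A B C :: "complex ^ 'n ^ 'n"
    by (simp add: vec_eq_iff matrix_matrix_mult_def distrib_right sum.distrib)
  show ?thesis
    by (simp add: HK_support_def matrix_add_ldistrib add_left matrix_mult_scaleR_right
        matrix_mult_scaleR_left trace_add trace_scaleR field_simps)
qed

text \<open>Fix the optimal \<open>K\<close> and \<open>P\<close> for \<open>G\<close>. The strict
  gap keeps \<open>K\<close> below \<open>G + h *\<^sub>R H\<close> for small \<open>h\<close>, so
  the same support still bounds the integrand there, and \<open>HK_support_affine\<close> supplies
  the slope.\<close>

lemma HK_integrand_local_support:
  fixes G H :: "real ^ 'n ^ 'n" and \<xi> :: "complex ^ 'n ^ 'n"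
  assumes \<xi>: "transpose \<xi> = \<xi>"
    and G: "pos_definite G" "spectral_radius (HK_mat \<xi> (cmat G)) < 1"
  shows "\<exists>c e. 0 < e \<and> (\<forall>h. \<bar>h\<bar> < e \<longrightarrow> pos_definite (G + h *\<^sub>R H) \<longrightarrow>
      spectral_radius (HK_mat \<xi> (cmat (G + h *\<^sub>R H))) < 1 \<longrightarrow>
      - ln (det G) + HK_rho (HK_mat \<xi> (cmat G)) + c * h
      \<le> - ln (det (G + h *\<^sub>R H)) + HK_rho (HK_mat \<xi> (cmat (G + h *\<^sub>R H))))"
proof -
  have real: "map_matrix cnj (cmat A) = cmat A" for A :: "real ^ 'n ^ 'n"
    by (simp add: vec_eq_iff)
  obtain K P where K: "herm_pd K" and KG: "\<And>x. x \<noteq> 0 \<Longrightarrow> x \<bullet> (K *v x) < x \<bullet> (cmat G *v x)"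
    and P: "P ** K = mat 1"
    and eq: "HK_support \<xi> K P (cmat G) = - ln (Re (det (cmat G))) + HK_rho (HK_mat \<xi> (cmat G))"
    using HK_support_attained[OF herm_pd_cmat[OF G(1)] real \<xi> G(2)] by blast
  have comb: "cmat (G + h *\<^sub>R H) = cmat G + h *\<^sub>R cmat H" for h
    by (simp add: vec_eq_iff scaleR_conv_of_real[where 'a = complex])
  have dist: "(A - B) *v x = A *v x - B *v x" "(A + B) *v x = A *v x + B *v x" "(h *\<^sub>R A) *v x = h *\<^sub>R (A *v x)"
    for A B :: "complex ^ 'n ^ 'n" and h x
    by (simp_all add: matrix_vector_mult_def vec_eq_iff algebra_simps sum.distrib sum_subtractf scaleR_sum_right)
  have "0 < x \<bullet> ((cmat G - K) *v x)" if "x \<noteq> 0" for x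
    using KG[OF that] by (simp add: dist inner_diff_right)
  from quadratic_form_perturbation[OF linear_cmatrix[of "cmat G - K"] linear_cmatrix[of "cmat H"] this]
  obtain e where e: "e > 0" and
    low: "\<And>h x. \<bar>h\<bar> < e \<Longrightarrow> 0 \<le> x \<bullet> ((cmat G - K) *v x) + h * (x \<bullet> (cmat H *v x))"
    by blast
  have KG': "x \<bullet> (K *v x) \<le> x \<bullet> (cmat (G + h *\<^sub>R H) *v x)" if "\<bar>h\<bar> < e" for h x
    using low[OF that, of x] by (simp add: comb dist inner_add_right inner_diff_right)
  define c where "c = Re (trace (K ** \<xi> ** cmat H ** adj \<xi>)) / 2 - Re (trace (P ** cmat H)) / 2"
  have "- ln (det G) + HK_rho (HK_mat \<xi> (cmat G)) + c * h
      \<le> - ln (det (G + h *\<^sub>R H)) + HK_rho (HK_mat \<xi> (cmat (G + h *\<^sub>R H)))"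
    if h: "\<bar>h\<bar> < e" "pos_definite (G + h *\<^sub>R H)" "spectral_radius (HK_mat \<xi> (cmat (G + h *\<^sub>R H))) < 1" for h
  proof -
    have "- ln (det G) + HK_rho (HK_mat \<xi> (cmat G)) + c * h = HK_support \<xi> K P (cmat (G + h *\<^sub>R H))"
      unfolding comb HK_support_affine c_def[symmetric] eq det_cmat by simp
    also have "\<dots> \<le> - ln (det (G + h *\<^sub>R H)) + HK_rho (HK_mat \<xi> (cmat (G + h *\<^sub>R H)))"
      using HK_support_le[OF herm_pd_cmat[OF h(2)] real \<xi> h(3) K KG'[OF h(1)] P] by (simp add: det_cmat)
    finally show ?thesis .
  qed
  then show ?thesis using e by blast
qed

section \<open>Convexity along paths\<close>

text \<open>Continuity cannot be dropped: a lower semicontinuous step function has local affine supports everywhere.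
  At the leftmost maximum \<open>c\<close> of the excess over a chord, a local support must have slope zero,
  which makes points to the left of \<open>c\<close> maximal as well.\<close>

lemma convex_on_local_support:
  fixes \<phi> :: "real \<Rightarrow> real"
  assumes cont: "continuous_on {a..b} \<phi>"
    and supp: "\<And>t. t \<in> {a..b} \<Longrightarrow>
      \<exists>c e. 0 < e \<and> (\<forall>s\<in>{a..b}. \<bar>s - t\<bar> < e \<longrightarrow> \<phi> t + c * (s - t) \<le> \<phi> s)"
  shows "convex_on {a..b} \<phi>"
proof (rule convex_on_linorderI)
  fix t x y :: real
  assume t: "0 < t" "t < 1" and xy: "x \<in> {a..b}" "y \<in> {a..b}" "x < y"
  define k where "k = (\<phi> y - \<phi> x) / (y - x)"
  define g where "g s = \<phi> s - (\<phi> x + k * (s - x))" for s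
  define z where "z = (1 - t) * x + t * y"
  have sub: "{x..y} \<subseteq> {a..b}" using xy by auto
  have contg: "continuous_on {x..y} g"
    unfolding g_def by (intro continuous_intros continuous_on_subset[OF cont sub])
  have gxy: "g x = 0" "g y = 0" using xy by (auto simp: g_def k_def)
  have "0 \<le> t * (y - x)" "0 \<le> (1 - t) * (y - x)" using t xy by auto
  then have z: "z \<in> {x..y}" by (auto simp: z_def algebra_simps)
  have "g z \<le> 0"
  proof (rule ccontr)
    assume gz: "\<not> g z \<le> 0"
    obtain c0 where c0: "c0 \<in> {x..y}" "\<And>s. s \<in> {x..y} \<Longrightarrow> g s \<le> g c0"
      using continuous_attains_sup[OF compact_Icc _ contg] xy by force
    define M where "M = {s \<in> {x..y}. g s = g c0}"
    have "closed M"
      unfolding M_def by (intro continuous_closed_preimage_constant contg) auto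
    then have "compact ({x..y} \<inter> M)" by (intro compact_Int_closed) auto
    also have "{x..y} \<inter> M = M" by (auto simp: M_def)
    finally have "compact M" .
    moreover have "M \<noteq> {}" using c0 by (auto simp: M_def)
    ultimately obtain c where c: "c \<in> M" "\<And>s. s \<in> M \<Longrightarrow> c \<le> s"
      using compact_attains_inf[of M] by blast
    have cx: "c \<in> {x..y}" "g c = g c0" using c by (auto simp: M_def)
    have "g c > 0" using gz c0 z cx by force
    then have cxy: "x < c" "c < y" using gxy cx by (auto simp: order.order_iff_strict)
    obtain \<alpha> e where e: "0 < e" "\<And>s. s \<in> {a..b} \<Longrightarrow> \<bar>s - c\<bar> < e \<Longrightarrow> \<phi> c + \<alpha> * (s - c) \<le> \<phi> s"
      using supp[of c] cx sub by blast
    define d where "d = min (e / 2) (min (c - x) (y - c))"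
    have d: "0 < d" "d < e" "c - d \<in> {x..y}" "c + d \<in> {x..y}"
      using e cxy by (auto simp: d_def)
    have sup: "g c + (\<alpha> - k) * (s - c) \<le> g s" if "s \<in> {x..y}" "\<bar>s - c\<bar> < e" for s
      using e(2)[of s] that sub by (auto simp: g_def algebra_simps)
    \<comment> \<open>Maximality of \<open>g c\<close> tested at \<open>c + d\<close> makes the
      slope nonpositive; the support at \<open>c - d\<close> then gives a value of at least
      \<open>g c\<close> there.\<close>
    have "(\<alpha> - k) * d \<le> 0"
      using sup[of "c + d"] c0(2)[of "c + d"] d cx by auto
    then have "\<alpha> - k \<le> 0" using d by (simp add: mult_le_0_iff)
    then have "g c \<le> g (c - d)"
      using sup[of "c - d"] d mult_nonpos_nonpos[of "\<alpha> - k" "- d"] by auto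
    then have "c - d \<in> M" using c0 cx d by (force simp: M_def)
    then show False using c(2)[of "c - d"] d by simp
  qed
  then have "\<phi> z \<le> \<phi> x + k * (z - x)" by (simp add: g_def)
  also have "z - x = t * (y - x)" by (simp add: z_def algebra_simps)
  also have "\<phi> x + k * (t * (y - x)) = (1 - t) * \<phi> x + t * \<phi> y"
    using xy by (simp add: k_def field_simps)
  finally show "\<phi> ((1 - t) *\<^sub>R x + t *\<^sub>R y) \<le> (1 - t) * \<phi> x + t * \<phi> y"
    by (simp add: z_def)
qed auto

section \<open>Continuity of spectral traces\<close>

primrec mpow :: "complex ^ 'n ^ 'n \<Rightarrow> nat \<Rightarrow> complex ^ 'n ^ 'n" where
  "mpow A 0 = mat 1"
| "mpow A (Suc k) = A ** mpow A k"

lemma mpow_diagonalizable: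
  fixes V V' :: "complex ^ 'n ^ 'n"
  assumes V: "V ** V' = mat 1"
  shows "mpow (V ** diagm l ** V') k = V ** diagm (\<lambda>i. l i ^ k) ** V'"
proof (induction k)
  case 0
  then show ?case by (simp add: diagm_1 V)
next
  case (Suc k)
  have V': "V' ** V = mat 1" using V by (simp add: matrix_left_right_inverse)
  have "mpow (V ** diagm l ** V') (Suc k) = V ** diagm l ** (V' ** V) ** diagm (\<lambda>i. l i ^ k) ** V'"
    by (simp only: mpow.simps Suc matrix_mul_assoc)
  also have "\<dots> = V ** (diagm l ** diagm (\<lambda>i. l i ^ k)) ** V'"
    by (simp only: V' matrix_mul_rid matrix_mul_assoc)
  finally show ?case by (simp add: diagm_mult)
qed

lemma continuous_on_matrix_mult:
  fixes A B :: "'a::topological_space \<Rightarrow> complex ^ 'n ^ 'n"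
  assumes "continuous_on X A" "continuous_on X B"
  shows "continuous_on X (\<lambda>x. A x ** B x)"
  unfolding matrix_matrix_mult_def by (intro continuous_intros assms)

lemma continuous_on_mpow:
  fixes A :: "'a::topological_space \<Rightarrow> complex ^ 'n ^ 'n"
  assumes "continuous_on X A"
  shows "continuous_on X (\<lambda>x. mpow (A x) k)"
  by (induction k) (simp_all add: continuous_on_matrix_mult assms)

text \<open>No continuous choice of eigenvalues or eigenvectors is made. For a polynomial the trace
  is a combination of traces of powers, continuous in the entries; Weierstrass approximation on
  \<open>{0..1}\<close> costs at most the dimension times the uniform error, and uniform limits
  preserve continuity.\<close>

lemma continuous_on_trace_fun:
  fixes A :: "'a::topological_space \<Rightarrow> complex ^ 'n ^ 'n"
  assumes A: "continuous_on X A" and g: "continuous_on {0..1} g"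
    and diag: "\<And>x. x \<in> X \<Longrightarrow> \<exists>(V :: complex ^ 'n ^ 'n) V' l. V ** V' = mat 1 \<and> A x = V ** diagm l ** V' \<and> (\<forall>i. l i \<in> {0..1})"
  shows "continuous_on X (\<lambda>x. trace_fun g (A x))"
proof -
  have "\<exists>a d. \<forall>x\<in>{0..1}. \<bar>g x - (\<Sum>k\<le>d. a k * x ^ k)\<bar> < 1 / real (Suc n)" for n
  proof -
    have "0 < 1 / real (Suc n)" by simp
    then obtain q where "real_polynomial_function q" "\<And>x. x \<in> {0..1} \<Longrightarrow> \<bar>g x - q x\<bar> < 1 / real (Suc n)"
      using Stone_Weierstrass_real_polynomial_function[OF compact_Icc g] by blast
    then show ?thesis unfolding real_polynomial_function_iff_sum by blast
  qed
  then obtain a d where ad: "\<And>n x. x \<in> {0..1} \<Longrightarrow> \<bar>g x - (\<Sum>k\<le>d n. a n k * x ^ k)\<bar> < 1 / real (Suc n)"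
    by metis
  \<comment> \<open>polynomial approximants of \<open>g\<close>, expressed through traces of powers\<close>
  define f where "f n x = (\<Sum>k\<le>d n. a n k * Re (trace (mpow (A x) k)))" for n x
  have err: "\<bar>f n x - trace_fun g (A x)\<bar> \<le> CARD('n) / real (Suc n)" if x: "x \<in> X" for n x
  proof -
    obtain V V' :: "complex ^ 'n ^ 'n" and l where V: "V ** V' = mat 1" and Ax: "A x = V ** diagm l ** V'" and l: "\<And>i. l i \<in> {0..1}"
      using diag[OF x] by blast
    have V': "V' ** V = mat 1" using V by (simp add: matrix_left_right_inverse)
    have "trace (V ** diagm m ** V') = complex_of_real (\<Sum>i\<in>UNIV. m i)" for m
      using trace_mul_sym[of "V ** diagm m" V'] by (simp add: matrix_mul_assoc V' trace_diagm)
    then have "f n x = (\<Sum>k\<le>d n. \<Sum>i\<in>UNIV. a n k * l i ^ k)"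
      unfolding f_def Ax mpow_diagonalizable[OF V] by (simp add: sum_distrib_left)
    also have "\<dots> = (\<Sum>i\<in>UNIV. \<Sum>k\<le>d n. a n k * l i ^ k)" by (rule sum.swap)
    finally have "f n x - trace_fun g (A x) = (\<Sum>i\<in>UNIV. (\<Sum>k\<le>d n. a n k * l i ^ k) - g (l i))"
      unfolding Ax trace_fun_diagonalizable[OF V] by (simp add: sum_subtractf)
    also have "\<bar>\<dots>\<bar> \<le> (\<Sum>i\<in>(UNIV::'n set). 1 / real (Suc n))"
      by (intro order.trans[OF sum_abs] sum_mono) (metis ad l abs_minus_commute less_imp_le)
    finally show ?thesis by simp
  qed
  have "uniform_limit X f (\<lambda>x. trace_fun g (A x)) sequentially"
  proof (rule uniform_limitI)
    fix e :: real assume "e > 0"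
    have "(\<lambda>n. real CARD('n) / real (Suc n)) \<longlonglongrightarrow> 0"
      by (intro real_tendsto_divide_at_top[OF tendsto_const] filterlim_compose[OF filterlim_real_sequentially] filterlim_Suc)
    then have "\<forall>\<^sub>F n in sequentially. CARD('n) / real (Suc n) < e"
      using \<open>e > 0\<close> by (rule order_tendstoD)
    then show "\<forall>\<^sub>F n in sequentially. \<forall>x\<in>X. dist (f n x) (trace_fun g (A x)) < e"
      unfolding dist_real_def by eventually_elim (blast intro: le_less_trans[OF err])
  qed
  moreover have "continuous_on X (f n)" for n
    unfolding f_def trace_def by (intro continuous_intros continuous_on_mpow A)
  ultimately show ?thesis
    by (intro uniform_limit_theorem[where F = sequentially and f = f]) auto
qed

section \<open>Continuity and convexity of the integrand\<close>

lemma continuous_on_HK_f: "continuous_on {0..1} HK_f"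
proof -
  have "1 + sqrt (1 - x) \<noteq> 0" if "x \<in> {0..1}" for x :: real
  proof -
    have "0 \<le> sqrt (1 - x)" using that by simp
    then show ?thesis by linarith
  qed
  then show ?thesis
    unfolding HK_f_def by (intro continuous_intros) auto
qed

text \<open>Along an admissible path the energy is half the integral of this function; taking plain
  matrices as arguments makes convexity a pointwise question.\<close>

definition HK_integrand :: "complex ^ 'n ^ 'n \<Rightarrow> real ^ 'n ^ 'n \<Rightarrow> real" where
  "HK_integrand \<xi> G = - ln (det G) + HK_rho (HK_mat \<xi> (cmat G))"

text \<open>The parameter space is arbitrary because continuity is used twice: in \<open>t\<close>
  at a fixed point of the torus for convexity, and in the torus variable at fixed \<open>t\<close>
  for integrability.\<close>

lemma continuous_on_HK_terms:
  fixes G :: "'a::topological_space \<Rightarrow> real ^ 'n ^ 'n" and \<xi> :: "'a \<Rightarrow> complex ^ 'n ^ 'n"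
  assumes cont: "continuous_on X G" "continuous_on X \<xi>"
    and pd: "\<And>x. x \<in> X \<Longrightarrow> pos_definite (G x)" and sym: "\<And>x. x \<in> X \<Longrightarrow> transpose (\<xi> x) = \<xi> x"
    and r: "\<And>x. x \<in> X \<Longrightarrow> spectral_radius (HK_mat (\<xi> x) (cmat (G x))) < 1"
  shows "continuous_on X (\<lambda>x. ln (det (G x)))"
    and "continuous_on X (\<lambda>x. HK_rho (HK_mat (\<xi> x) (cmat (G x))))"
proof -
  have "continuous_on X (\<lambda>x. det (G x))"
    unfolding det_def by (intro continuous_intros cont)
  then show "continuous_on X (\<lambda>x. ln (det (G x)))"
    by (rule continuous_on_ln) (use pos_definite_det[OF pd] in force)
  have "continuous_on X (\<lambda>x. cmat (G x))" "continuous_on X (\<lambda>x. map_matrix cnj (\<xi> x))"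
    unfolding map_matrix_def by (intro continuous_intros cont)+
  then have "continuous_on X (\<lambda>x. HK_mat (\<xi> x) (cmat (G x)))"
    unfolding HK_mat_def by (intro continuous_on_matrix_mult cont)
  then show "continuous_on X (\<lambda>x. HK_rho (HK_mat (\<xi> x) (cmat (G x))))"
    unfolding HK_rho_def
  proof (rule continuous_on_trace_fun[OF _ continuous_on_HK_f])
    fix x assume x: "x \<in> X"
    have real: "map_matrix cnj (cmat A) = cmat A" for A :: "real ^ 'n ^ 'n"
      by (simp add: vec_eq_iff)
    obtain R R' U :: "complex ^ 'n ^ 'n" and l where
      A: "HK_mat (\<xi> x) (cmat (G x)) = (R' ** U) ** diagm l ** (adj U ** R)"
      and inv: "(R' ** U) ** (adj U ** R) = mat 1" and l0: "\<And>i. 0 \<le> l i"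
      by (rule HK_mat_diagonalization[OF herm_pd_cmat[OF pd[OF x]] real sym[OF x]], rule that)
    have "l i \<in> {0..1}" for i
      using l0 diagonalization_spectral_bound[OF inv r[OF x, unfolded A], of i] by (simp add: less_imp_le)
    then show "\<exists>(V :: complex ^ 'n ^ 'n) V' l. V ** V' = mat 1 \<and> HK_mat (\<xi> x) (cmat (G x)) = V ** diagm l ** V'
        \<and> (\<forall>i. l i \<in> {0..1})"
      using A inv by blast
  qed
qed

text \<open>Moving \<open>G t\<close> in the direction \<open>B - A\<close> stays on the line
  through \<open>A\<close> and \<open>B\<close>, so the local matrix supports become local supports
  in \<open>t\<close>.\<close>

lemma convex_on_HK_integrand:
  fixes A B :: "real ^ 'n ^ 'n" and \<xi> :: "complex ^ 'n ^ 'n"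
  defines "G \<equiv> \<lambda>t. (1 - t) *\<^sub>R A + t *\<^sub>R B"
  assumes \<xi>: "transpose \<xi> = \<xi>"
    and pd: "\<And>t. t \<in> {0..1} \<Longrightarrow> pos_definite (G t)"
    and r: "\<And>t. t \<in> {0..1} \<Longrightarrow> spectral_radius (HK_mat \<xi> (cmat (G t))) < 1"
  shows "convex_on {0..1} (\<lambda>t. HK_integrand \<xi> (G t))"
proof (rule convex_on_local_support)
  have "continuous_on {0..1} G" unfolding G_def by (intro continuous_intros)
  then show "continuous_on {0..1} (\<lambda>t. HK_integrand \<xi> (G t))"
    unfolding HK_integrand_def
    using continuous_on_HK_terms[of "{0..1}" G "\<lambda>_. \<xi>"] \<xi> pd r by (intro continuous_on_add continuous_on_minus) auto
next
  fix t :: real assume t: "t \<in> {0..1}"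
  obtain c e where e: "0 < e" and ineq: "\<And>h. \<bar>h\<bar> < e \<Longrightarrow> pos_definite (G t + h *\<^sub>R (B - A)) \<Longrightarrow>
      spectral_radius (HK_mat \<xi> (cmat (G t + h *\<^sub>R (B - A)))) < 1 \<Longrightarrow>
      HK_integrand \<xi> (G t) + c * h \<le> HK_integrand \<xi> (G t + h *\<^sub>R (B - A))"
    using HK_integrand_local_support[OF \<xi> pd[OF t] r[OF t], of "B - A"] unfolding HK_integrand_def by blast
  have "G t + (s - t) *\<^sub>R (B - A) = G s" for s
    by (simp add: G_def algebra_simps)
  then have "HK_integrand \<xi> (G t) + c * (s - t) \<le> HK_integrand \<xi> (G s)" if "s \<in> {0..1}" "\<bar>s - t\<bar> < e" for s
    using ineq[of "s - t"] pd r that by simp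
  then show "\<exists>c e. 0 < e \<and> (\<forall>s\<in>{0..1}. \<bar>s - t\<bar> < e \<longrightarrow>
      HK_integrand \<xi> (G t) + c * (s - t) \<le> HK_integrand \<xi> (G s))"
    using e by blast
qed

section \<open>Integration over the torus\<close>

lemma partial_deriv_eq: "(f has_derivative f') (at y) \<Longrightarrow> partial_deriv i f y = f' (axis i 1)"
  unfolding partial_deriv_def by (metis frechet_derivative_at)

lemma partial_deriv_linear_comb:
  fixes f g :: "real ^ 'n \<Rightarrow> real"
  assumes "f differentiable (at y)" "g differentiable (at y)"
  shows "partial_deriv i (\<lambda>y. a * f y + b * g y) y = a * partial_deriv i f y + b * partial_deriv i g y"
proof -
  have "((\<lambda>y. a * f y + b * g y) has_derivative
      (\<lambda>h. a * frechet_derivative f (at y) h + b * frechet_derivative g (at y) h)) (at y)"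
    using assms by (auto intro!: derivative_eq_intros simp: frechet_derivative_works)
  from partial_deriv_eq[OF this] show ?thesis by (simp add: partial_deriv_def)
qed

lemma smooth_continuous: "smooth f \<Longrightarrow> continuous_on UNIV f"
  using C_class.simps(1) smooth_def by blast

lemma smooth_C2:
  assumes "smooth f"
  shows "f differentiable (at y)" "partial_deriv i f differentiable (at y)"
    "continuous_on UNIV (partial_deriv i (partial_deriv j f))"
  using assms C_class.simps unfolding smooth_def by metis+

text \<open>Smoothness is given for the periodic part only; the derivatives of the quadratic part
  are computed explicitly and contribute the identity matrix to the Hessian.\<close>

lemma symplectic_potential_C2:
  fixes u :: "real ^ 'n \<Rightarrow> real"
  assumes "symplectic_potential u"
  shows "u differentiable (at y)" "partial_deriv i u differentiable (at y)"
    "continuous_on UNIV (hessian u)"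
proof -
  obtain \<phi> where \<phi>: "smooth \<phi>" and u: "u = (\<lambda>y. 1/2 * (y \<bullet> y) + 1 * \<phi> y)"
    using assms unfolding symplectic_potential_def by (auto simp: power2_norm_eq_inner fun_eq_iff)
  note C2 = smooth_C2[OF \<phi>]
  have sq: "((\<lambda>y :: real ^ 'n. y \<bullet> y) has_derivative (\<lambda>h. 2 * (y \<bullet> h))) (at y)" for y
    by (auto intro!: derivative_eq_intros simp: inner_commute)
  have sqd: "(\<lambda>y :: real ^ 'n. y \<bullet> y) differentiable (at y)" for y
    using sq differentiableI by blast
  have pd: "partial_deriv i u = (\<lambda>y. 1 * y $ i + 1 * partial_deriv i \<phi> y)" for i
    unfolding u by (rule ext, subst partial_deriv_linear_comb[OF sqd C2(1)])
      (simp add: partial_deriv_eq[OF sq] inner_axis)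
  have comp: "((\<lambda>y :: real ^ 'n. y $ j) has_derivative (\<lambda>h. h $ j)) (at y)" for j y
    by (intro bounded_linear_imp_has_derivative bounded_linear_vec_nth)
  have compd: "(\<lambda>y :: real ^ 'n. y $ j) differentiable (at y)" for j y
    using comp differentiableI by blast
  have pdd: "partial_deriv i (partial_deriv j u) = (\<lambda>y. axis i 1 $ j + partial_deriv i (partial_deriv j \<phi>) y)" for i j
    unfolding pd by (rule ext, subst partial_deriv_linear_comb[OF compd C2(2)])
      (simp add: partial_deriv_eq[OF comp])
  show "u differentiable (at y)"
    unfolding u using sqd C2(1) by (intro derivative_intros)
  show "partial_deriv i u differentiable (at y)"
    unfolding pd using compd C2(2) by (intro derivative_intros)
  show "continuous_on UNIV (hessian u)"
    unfolding hessian_def pdd by (intro continuous_intros C2(3))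
qed

text \<open>Turns a linear path of potentials into a segment of matrices at each point, as
  \<open>convex_on_HK_integrand\<close> requires.\<close>

lemma hessian_linear_comb:
  fixes u v :: "real ^ 'n \<Rightarrow> real"
  assumes "symplectic_potential u" "symplectic_potential v"
  shows "hessian (\<lambda>y. a * u y + b * v y) y = a *\<^sub>R hessian u y + b *\<^sub>R hessian v y"
proof -
  note C2 = symplectic_potential_C2(1,2)[OF assms(1)] symplectic_potential_C2(1,2)[OF assms(2)]
  have "partial_deriv j (\<lambda>y. a * u y + b * v y) = (\<lambda>y. a * partial_deriv j u y + b * partial_deriv j v y)" for j
    by (rule ext, rule partial_deriv_linear_comb) (rule C2)+
  moreover have "partial_deriv i (\<lambda>y. a * partial_deriv j u y + b * partial_deriv j v y) y
      = a * partial_deriv i (partial_deriv j u) y + b * partial_deriv i (partial_deriv j v) y" for i j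
    by (rule partial_deriv_linear_comb) (rule C2)+
  ultimately show ?thesis by (simp add: hessian_def vec_eq_iff)
qed

section \<open>Convexity of the energy by integration\<close>

theorem theorem1p5:
  fixes \<xi> :: "real ^ 'n \<Rightarrow> complex ^ 'n ^ 'n"
    and u0 u1 :: "real ^ 'n \<Rightarrow> real"
  assumes "Higgs_tensor \<xi>"
    and "symplectic_potential u0" and "symplectic_potential u1"
    and "\<And>t. t \<in> {0..1} \<Longrightarrow> (\<lambda>y. (1 - t) * u0 y + t * u1 y) \<in> HK_domain \<xi>"
  shows "convex_on {0..1} (\<lambda>t. HK_energy (\<lambda>y. (1 - t) * u0 y + t * u1 y) \<xi>)"
proof -
  define G where "G t y = (1 - t) *\<^sub>R hessian u0 y + t *\<^sub>R hessian u1 y" for t y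
  define Q :: "(real ^ 'n) set" where "Q = cbox 0 1"
  have hess: "hessian (\<lambda>y. (1 - t) * u0 y + t * u1 y) = G t" for t
    unfolding G_def by (rule ext) (rule hessian_linear_comb[OF assms(2,3)])
  have mat: "HK_matrix (\<lambda>y. (1 - t) * u0 y + t * u1 y) \<xi> y = HK_mat (\<xi> y) (cmat (G t y))" for t y
    unfolding HK_matrix_def HK_mat_def hess ..
  have \<xi>: "transpose (\<xi> y) = \<xi> y" "continuous_on UNIV \<xi>" for y
    using assms(1) smooth_continuous unfolding Higgs_tensor_def by auto
  have pd: "pos_definite (G t y)" and r: "spectral_radius (HK_mat (\<xi> y) (cmat (G t y))) < 1"
    if "t \<in> {0..1}" for t y
  proof -
    have "pos_definite (hessian (\<lambda>y. (1 - t) * u0 y + t * u1 y) y)"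
      "spectral_radius (HK_matrix (\<lambda>y. (1 - t) * u0 y + t * u1 y) \<xi> y) < 1"
      using assms(4)[OF that] unfolding HK_domain_def symplectic_potential_def by blast+
    then show "pos_definite (G t y)" "spectral_radius (HK_mat (\<xi> y) (cmat (G t y))) < 1"
      unfolding hess mat .
  qed
  have "continuous_on UNIV (G t)" for t
    unfolding G_def using assms(2,3)[THEN symplectic_potential_C2(3)] by (intro continuous_intros)
  then have cont: "continuous_on Q (G t)" "continuous_on Q \<xi>" for t
    using \<xi>(2) continuous_on_subset by blast+
  \<comment> \<open>Continuity on the compact cube gives integrability. The first two facts allow
    the energy to be written as a single integral; the third allows the pointwise convexity
    inequality to be integrated.\<close>
  have int: "set_integrable lborel Q (\<lambda>y. ln (det (G t y)))"
      "set_integrable lborel Q (\<lambda>y. HK_rho (HK_mat (\<xi> y) (cmat (G t y))))"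
      "set_integrable lborel Q (\<lambda>y. HK_integrand (\<xi> y) (G t y))"
    if t: "t \<in> {0..1}" for t
  proof -
    note terms = continuous_on_HK_terms[OF cont pd[OF t] \<xi>(1) r[OF t]]
    have "continuous_on Q (\<lambda>y. HK_integrand (\<xi> y) (G t y))"
      unfolding HK_integrand_def by (intro continuous_on_add continuous_on_minus terms)
    with terms show "set_integrable lborel Q (\<lambda>y. ln (det (G t y)))"
      "set_integrable lborel Q (\<lambda>y. HK_rho (HK_mat (\<xi> y) (cmat (G t y))))"
      "set_integrable lborel Q (\<lambda>y. HK_integrand (\<xi> y) (G t y))"
      unfolding set_integrable_def Q_def by (intro borel_integrable_compact compact_cbox; simp)+
  qed
  define I where "I t = (LINT y:Q|lborel. HK_integrand (\<xi> y) (G t y))" for t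
  have energy: "HK_energy (\<lambda>y. (1 - t) * u0 y + t * u1 y) \<xi> = 1/2 * I t" if "t \<in> {0..1}" for t
  proof -
    have "I t = (LINT y:Q|lborel. HK_rho (HK_mat (\<xi> y) (cmat (G t y))) - ln (det (G t y)))"
      unfolding I_def HK_integrand_def by simp
    also have "\<dots> = (LINT y:Q|lborel. HK_rho (HK_mat (\<xi> y) (cmat (G t y)))) - (LINT y:Q|lborel. ln (det (G t y)))"
      by (rule set_integral_diff(2)) (use int that in auto)
    finally show ?thesis
      unfolding HK_energy_def torus_integral_def hess mat Q_def[symmetric] by simp
  qed
  show ?thesis
  proof (rule convex_onI)
    fix l s t :: real assume l: "0 < l" "l < 1" and st: "s \<in> {0..1}" "t \<in> {0..1}"
    have m: "(1 - l) *\<^sub>R s + l *\<^sub>R t \<in> {0..1}"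
      using l st by (intro convexD_alt) auto
    have "I ((1 - l) *\<^sub>R s + l *\<^sub>R t)
        \<le> (LINT y:Q|lborel. (1 - l) * HK_integrand (\<xi> y) (G s y) + l * HK_integrand (\<xi> y) (G t y))"
      unfolding I_def
    proof (rule set_integral_mono)
      fix y
      have "convex_on {0..1} (\<lambda>t. HK_integrand (\<xi> y) (G t y))"
        unfolding G_def by (rule convex_on_HK_integrand) (use \<xi> pd r in \<open>auto simp: G_def\<close>)
      from convex_onD[OF this, of l s t] l st
      show "HK_integrand (\<xi> y) (G ((1 - l) *\<^sub>R s + l *\<^sub>R t) y)
          \<le> (1 - l) * HK_integrand (\<xi> y) (G s y) + l * HK_integrand (\<xi> y) (G t y)" by simp
    qed (use int m st in auto)
    also have "\<dots> = (1 - l) * I s + l * I t"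
      unfolding I_def using int st by (subst set_integral_add(2)) auto
    finally show "HK_energy (\<lambda>y. (1 - ((1 - l) *\<^sub>R s + l *\<^sub>R t)) * u0 y + ((1 - l) *\<^sub>R s + l *\<^sub>R t) * u1 y) \<xi>
        \<le> (1 - l) * HK_energy (\<lambda>y. (1 - s) * u0 y + s * u1 y) \<xi> + l * HK_energy (\<lambda>y. (1 - t) * u0 y + t * u1 y) \<xi>"
      unfolding energy[OF m] energy[OF st(1)] energy[OF st(2)] by simp
  qed auto
qed

end
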